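(* There is a functorial isomorphism (of topological spaces, i.e. a homeomorphism), for any $P\in\mathcal{P}$: $$|P|\cong|\mathcal{S}(P)|,$$ where $|P|$ is the geometric realization of the finite partially ordered set $P$ and $|\mathcal{S}(P)|$ is the geometric realization of the simplicial set $\mathcal{S}(P)$.
   Context: $\mathcal{P}$ is the category of finite partially ordered sets with order preserving (weakly monotone) maps. For $n\ge 0$, $[n]=\{0<1<\cdots<n\}$, and $\Delta$ is the full subcategory of $\mathcal{P}$ on the objects $[n]$. Simplicial sets are contravariant functors from $\Delta$ to the category of sets, with natural transformations as maps. $\Delta_n$ is the simplicial set represented by $[n]$. The simplicial realization of $P\in\mathcal P$ is the simplicial set $\mathcal{S}(P)$ with $\mathcal{S}(P)([n])=\operatorname{Hom}_{\mathcal{P}}([n],P)$; it is functorial in $P$. The topological standard $n$-simplex is $|\Delta_n|=\{(x_0,\ldots,x_n)\in\mathbb{R}^{n+1}: x_i\ge 0,\ \sum x_i=1\}$ with the subspace topology; $\theta:[n]\to[m]$ induces $\theta_*:|\Delta_n|\to|\Delta_m|$, $\theta_*(t_0,\ldots,t_n)=(s_0,\ldots,s_m)$ with $s_i=\sum_{j\in\theta^{-1}(i)}t_j$. The geometric realization of a simplicial set $C$ is the colimit in topological spaces $|C|=\varinjlim_{\Delta_n\to C}|\Delta_n|$ over the category $\Delta\downarrow C$ whose objects are maps of simplicial sets $\Delta_n\to C$ and whose morphisms are commuting triangles over $C$. Geometric realization of a finite partially ordered set $P$: consider $P$ as a metric space by the discrete metric $d(x,y)=1-\delta_{xy}$. Then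 $|P|$ is the set of all order preserving upper semi-continuous maps $f:I=[0,1]\to P$ (for order preserving $f$, whose image is a finite chain, upper semi-continuity means that $\{t\in I: f(t)\ge p\}$ is closed for every $p$ in the image of $f$), given the structure of a metric space by the metric $d(f,g)=\int_0^1 d(f(t),g(t))\,dt$. For an order preserving map $h:P\to Q$, $|h|:|P|\to|Q|$ is $f\mapsto h\circ f$.
   Formalization: In |P|, maps at distance d(f,g)=0 are identified, since d is only a pseudometric on all order preserving upper semi-continuous maps: for q<p, the map equal to q on [0,1) and p at 1 has distance 0 from the constant map q. *)

theory Defs
  imports "HOL-Analysis.Analysis" "HOL-Homology.Simplices"
begin

section \<open>Finite partially ordered sets\<close>

text \<open>A poset is given by its (reflexive) order relation \<open>P\<close>; its underlying set is
  \<open>Field P\<close>.  The empty poset is allowed.  Order preserving maps are extensional,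
  i.e. \<^const>\<open>undefined\<close> outside of \<open>Field P\<close>, so that each of them is represented
  by exactly one HOL function.\<close>

definition finite_poset :: "'a rel \<Rightarrow> bool" where
  "finite_poset P \<longleftrightarrow> Partial_order P \<and> finite (Field P)"

definition order_maps :: "'a rel \<Rightarrow> 'b rel \<Rightarrow> ('a \<Rightarrow> 'b) set" where
  "order_maps P Q = {h \<in> Field P \<rightarrow>\<^sub>E Field Q. \<forall>x y. (x, y) \<in> P \<longrightarrow> (h x, h y) \<in> Q}"

definition ordinal :: "nat \<Rightarrow> nat rel" where
  "ordinal n = {(i, j). i \<le> j \<and> j \<le> n}"

lemma Field_ordinal [simp]: "Field (ordinal n) = {..n}"
  by (auto simp: ordinal_def Field_def)

lemma finite_poset_ordinal: "finite_poset (ordinal n)"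
  unfolding finite_poset_def order_on_defs Field_ordinal
  by (auto simp: ordinal_def refl_on_def intro!: transI antisymI)

lemma order_maps_compose:
  "f \<in> order_maps P Q \<Longrightarrow> g \<in> order_maps Q R \<Longrightarrow> compose (Field P) g f \<in> order_maps P R"
  unfolding order_maps_def by (auto simp: compose_def FieldI1 FieldI2)

lemma order_maps_id: "(\<lambda>x\<in>Field P. x) \<in> order_maps P P"
  unfolding order_maps_def by (auto simp: FieldI1 FieldI2)


section \<open>Simplicial sets\<close>

text \<open>\<open>act C m n \<theta>\<close> is the map \<open>C([n]) \<rightarrow> C([m])\<close> induced by
  \<open>\<theta> : [m] \<rightarrow> [n]\<close>.\<close>

record 's sset =
  simplices :: "nat \<Rightarrow> 's set"
  act :: "nat \<Rightarrow> nat \<Rightarrow> (nat \<Rightarrow> nat) \<Rightarrow> 's \<Rightarrow> 's"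

definition simplicial_set :: "'s sset \<Rightarrow> bool" where
  "simplicial_set C \<longleftrightarrow>
     (\<forall>m n. \<forall>\<theta> \<in> order_maps (ordinal m) (ordinal n). act C m n \<theta> \<in> simplices C n \<rightarrow> simplices C m) \<and>
     (\<forall>n. \<forall>x \<in> simplices C n. act C n n (\<lambda>i\<in>{..n}. i) x = x) \<and>
     (\<forall>l m n. \<forall>\<eta> \<in> order_maps (ordinal l) (ordinal m). \<forall>\<theta> \<in> order_maps (ordinal m) (ordinal n).
        \<forall>x \<in> simplices C n. act C l n (compose {..l} \<theta> \<eta>) x = act C l m \<eta> (act C m n \<theta> x))"

definition sset_maps :: "'s sset \<Rightarrow> 't sset \<Rightarrow> (nat \<Rightarrow> 's \<Rightarrow> 't) set" where
  "sset_maps C D = {\<alpha>. (\<forall>n. \<alpha> n \<in> simplices C n \<rightarrow>\<^sub>E simplices D n) \<and>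
     (\<forall>m n. \<forall>\<theta> \<in> order_maps (ordinal m) (ordinal n). \<forall>x \<in> simplices C n.
        act D m n \<theta> (\<alpha> n x) = \<alpha> m (act C m n \<theta> x))}"

definition sset_comp ::
  "'s sset \<Rightarrow> (nat \<Rightarrow> 't \<Rightarrow> 'u) \<Rightarrow> (nat \<Rightarrow> 's \<Rightarrow> 't) \<Rightarrow> nat \<Rightarrow> 's \<Rightarrow> 'u" where
  "sset_comp C \<beta> \<alpha> = (\<lambda>n. compose (simplices C n) (\<beta> n) (\<alpha> n))"

definition simp_real :: "'a rel \<Rightarrow> (nat \<Rightarrow> 'a) sset" where
  "simp_real P = \<lparr>simplices = (\<lambda>n. order_maps (ordinal n) P),
                  act = (\<lambda>m n \<theta> \<sigma>. compose {..m} \<sigma> \<theta>)\<rparr>"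

definition simp_real_map :: "'a rel \<Rightarrow> ('a \<Rightarrow> 'b) \<Rightarrow> nat \<Rightarrow> (nat \<Rightarrow> 'a) \<Rightarrow> (nat \<Rightarrow> 'b)" where
  "simp_real_map P h = (\<lambda>n. \<lambda>\<sigma>\<in>order_maps (ordinal n) P. compose {..n} h \<sigma>)"

text \<open>The simplicial set represented by \<open>[n]\<close>; since the category of the \<open>[n]\<close> is a full
  subcategory of the category of finite posets, it is literally \<open>S([n])\<close>.\<close>

abbreviation Delta :: "nat \<Rightarrow> (nat \<Rightarrow> nat) sset" where
  "Delta n \<equiv> simp_real (ordinal n)"

lemma simplicial_set_simp_real: "simplicial_set (simp_real P)"
proof -
  have "compose {..m} \<sigma> \<theta> \<in> order_maps (ordinal m) P"
    if "\<theta> \<in> order_maps (ordinal m) (ordinal n)" "\<sigma> \<in> order_maps (ordinal n) P" for m n \<theta> \<sigma>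
    using order_maps_compose[OF that] by simp
  moreover have "compose {..n} \<sigma> (\<lambda>i\<in>{..n}. i) = \<sigma>"
    if "\<sigma> \<in> order_maps (ordinal n) P" for n \<sigma>
    using that by (auto simp: order_maps_def compose_def PiE_def extensional_def fun_eq_iff)
  moreover have "compose {..l} \<sigma> (compose {..l} \<theta> \<eta>) = compose {..l} (compose {..m} \<sigma> \<theta>) \<eta>"
    if "\<eta> \<in> order_maps (ordinal l) (ordinal m)" for l m \<eta> \<sigma> \<theta>
    using that by (auto simp: order_maps_def compose_def fun_eq_iff PiE_iff)
  ultimately show ?thesis
    unfolding simplicial_set_def simp_real_def by auto
qed

lemma simp_real_map_in_sset_maps:
  assumes "h \<in> order_maps P Q"
  shows "simp_real_map P h \<in> sset_maps (simp_real P) (simp_real Q)"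
proof -
  have "compose {..n} h \<sigma> \<in> order_maps (ordinal n) Q" if "\<sigma> \<in> order_maps (ordinal n) P" for n \<sigma>
    using order_maps_compose[OF that assms] by simp
  moreover have "compose {..m} \<sigma> \<theta> \<in> order_maps (ordinal m) P"
    if "\<theta> \<in> order_maps (ordinal m) (ordinal n)" "\<sigma> \<in> order_maps (ordinal n) P" for m n \<theta> \<sigma>
    using order_maps_compose[OF that] by simp
  moreover have "compose {..m} (compose {..n} h \<sigma>) \<theta> = compose {..m} h (compose {..m} \<sigma> \<theta>)"
    if "\<theta> \<in> order_maps (ordinal m) (ordinal n)" for m n \<theta> \<sigma>
    using that by (auto simp: order_maps_def compose_def fun_eq_iff PiE_iff)
  ultimately show ?thesis
    unfolding sset_maps_def simp_real_def simp_real_map_def by auto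
qed


section \<open>Geometric realization of simplicial sets\<close>

text \<open>Points of real \<open>(n+1)\<close>-space are functions on \<open>nat\<close> that vanish above \<open>n\<close>.\<close>

definition top_simplex :: "nat \<Rightarrow> (nat \<Rightarrow> real) topology" where
  "top_simplex n = subtopology (Euclidean_space (Suc n)) (standard_simplex n)"

definition simplex_push :: "nat \<Rightarrow> (nat \<Rightarrow> nat) \<Rightarrow> (nat \<Rightarrow> real) \<Rightarrow> (nat \<Rightarrow> real)" where
  "simplex_push n \<theta> t = (\<lambda>i. \<Sum>j\<in>{j\<in>{..n}. \<theta> j = i}. t j)"

definition quotient_topology :: "'a topology \<Rightarrow> 'a rel \<Rightarrow> 'a set topology" where
  "quotient_topology X r =
     topology (\<lambda>U. U \<subseteq> topspace X // r \<and> openin X {x \<in> topspace X. r `` {x} \<in> U})"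

lemma openin_quotient_topology:
  "openin (quotient_topology X r) U \<longleftrightarrow>
     U \<subseteq> topspace X // r \<and> openin X {x \<in> topspace X. r `` {x} \<in> U}"
proof -
  have "{x \<in> topspace X. r `` {x} \<in> S \<inter> T} =
      {x \<in> topspace X. r `` {x} \<in> S} \<inter> {x \<in> topspace X. r `` {x} \<in> T}" for S T
    by auto
  moreover have "{x \<in> topspace X. r `` {x} \<in> \<Union>\<K>} =
      (\<Union>K\<in>\<K>. {x \<in> topspace X. r `` {x} \<in> K})" for \<K>
    by auto
  ultimately have "istopology (\<lambda>U. U \<subseteq> topspace X // r \<and> openin X {x \<in> topspace X. r `` {x} \<in> U})"
    unfolding istopology_def by auto
  then show ?thesis
    by (simp add: quotient_topology_def)
qed

lemma topspace_quotient_topology: "topspace (quotient_topology X r) = topspace X // r"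
proof -
  have "{x \<in> topspace X. r `` {x} \<in> topspace X // r} = topspace X"
    by (auto simp: quotient_def)
  then have "openin (quotient_topology X r) (topspace X // r)"
    by (simp add: openin_quotient_topology)
  then show ?thesis
    by (meson openin_quotient_topology openin_subset openin_topspace subset_antisym)
qed

text \<open>Objects of the category of simplices over \<open>C\<close>: pairs of \<open>n\<close> and a map of simplicial
  sets from \<open>Delta n\<close> to \<open>C\<close>.\<close>

definition over_objects :: "'s sset \<Rightarrow> (nat \<times> (nat \<Rightarrow> (nat \<Rightarrow> nat) \<Rightarrow> 's)) set" where
  "over_objects C = {(n, \<alpha>). \<alpha> \<in> sset_maps (Delta n) C}"

definition over_coproduct ::
  "'s sset \<Rightarrow> ((nat \<times> (nat \<Rightarrow> (nat \<Rightarrow> nat) \<Rightarrow> 's)) \<times> (nat \<Rightarrow> real)) topology" where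
  "over_coproduct C = sum_topology (\<lambda>a. top_simplex (fst a)) (over_objects C)"

text \<open>A morphism from \<open>(n, \<alpha>)\<close> to \<open>(m, \<beta>)\<close> is some \<open>\<theta> : [n] \<rightarrow> [m]\<close> with
  \<open>\<alpha> = \<beta> \<circ> S(\<theta>)\<close>.  The colimit of the spaces \<open>top_simplex n\<close> is the quotient of
  their disjoint union by the equivalence relation generated by identifying \<open>x\<close> in the
  copy at \<open>(n, \<alpha>)\<close> with its image in the copy at \<open>(m, \<beta>)\<close>.\<close>

inductive over_glue ::
  "'s sset \<Rightarrow> (nat \<times> (nat \<Rightarrow> (nat \<Rightarrow> nat) \<Rightarrow> 's)) \<times> (nat \<Rightarrow> real) \<Rightarrow>
     (nat \<times> (nat \<Rightarrow> (nat \<Rightarrow> nat) \<Rightarrow> 's)) \<times> (nat \<Rightarrow> real) \<Rightarrow> bool" for C where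
  "(n, \<alpha>) \<in> over_objects C \<Longrightarrow> (m, \<beta>) \<in> over_objects C \<Longrightarrow> \<theta> \<in> order_maps (ordinal n) (ordinal m) \<Longrightarrow>
   \<alpha> = sset_comp (Delta n) \<beta> (simp_real_map (ordinal n) \<theta>) \<Longrightarrow> x \<in> standard_simplex n \<Longrightarrow>
   over_glue C ((n, \<alpha>), x) ((m, \<beta>), simplex_push n \<theta> x)"

definition over_equiv ::
  "'s sset \<Rightarrow> ((nat \<times> (nat \<Rightarrow> (nat \<Rightarrow> nat) \<Rightarrow> 's)) \<times> (nat \<Rightarrow> real)) rel" where
  "over_equiv C = {(a, b). a \<in> topspace (over_coproduct C) \<and> b \<in> topspace (over_coproduct C) \<and>
                           equivclp (over_glue C) a b}"

lemma equiv_over_equiv: "equiv (topspace (over_coproduct C)) (over_equiv C)"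
  unfolding over_equiv_def
  by (intro equivI) (auto simp: refl_on_def sym_def trans_def
      intro: equivclp_sym equivclp_trans equivclp_refl)

definition geom_real ::
  "'s sset \<Rightarrow> ((nat \<times> (nat \<Rightarrow> (nat \<Rightarrow> nat) \<Rightarrow> 's)) \<times> (nat \<Rightarrow> real)) set topology" where
  "geom_real C = quotient_topology (over_coproduct C) (over_equiv C)"

text \<open>For \<open>\<phi> : C \<rightarrow> D\<close> the map \<open>|\<phi>|\<close> sends the class of \<open>((n, \<alpha>), x)\<close> to the class of
  \<open>((n, \<phi> \<circ> \<alpha>), x)\<close>; the union ranges over all representatives (and all of its members
  coincide).\<close>

definition geom_real_map ::
  "'t sset \<Rightarrow> (nat \<Rightarrow> 's \<Rightarrow> 't) \<Rightarrow>
   ((nat \<times> (nat \<Rightarrow> (nat \<Rightarrow> nat) \<Rightarrow> 's)) \<times> (nat \<Rightarrow> real)) set \<Rightarrow>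
   ((nat \<times> (nat \<Rightarrow> (nat \<Rightarrow> nat) \<Rightarrow> 't)) \<times> (nat \<Rightarrow> real)) set" where
  "geom_real_map D \<phi> c =
     (\<Union>((n, \<alpha>), x)\<in>c. over_equiv D `` {((n, sset_comp (Delta n) \<phi> \<alpha>), x)})"


section \<open>Geometric realization of finite posets\<close>

definition unit_interval :: "real rel" where
  "unit_interval = {(s, t). 0 \<le> s \<and> s \<le> t \<and> t \<le> 1}"

lemma Field_unit_interval [simp]: "Field unit_interval = {0..1}"
  by (force simp: unit_interval_def Field_def)

definition usc_maps :: "'a rel \<Rightarrow> (real \<Rightarrow> 'a) set" where
  "usc_maps P = {f \<in> order_maps unit_interval P.
     \<forall>p \<in> f ` {0..1}. closed {t \<in> {0..1}. (p, f t) \<in> P}}"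

definition usc_dist :: "(real \<Rightarrow> 'a) \<Rightarrow> (real \<Rightarrow> 'a) \<Rightarrow> real" where
  "usc_dist f g = integral {0..1} (\<lambda>t. discrete_metric.dd (f t) (g t))"

text \<open>On \<^const>\<open>usc_maps\<close> the integral is only a pseudometric: a map that is constant on
  \<open>[0,1)\<close> and jumps at the end point \<open>1\<close> is upper semi-continuous, and it has distance \<open>0\<close>
  from a constant map (see \<open>usc_dist_zero_not_eq\<close> below).  The metric space \<open>|P|\<close> is therefore
  the one associated with this pseudometric, i.e. maps at distance \<open>0\<close> are identified.\<close>

definition usc_equiv :: "'a rel \<Rightarrow> (real \<Rightarrow> 'a) rel" where
  "usc_equiv P = {(f, g). f \<in> usc_maps P \<and> g \<in> usc_maps P \<and> usc_dist f g = 0}"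

definition poset_points :: "'a rel \<Rightarrow> (real \<Rightarrow> 'a) set set" where
  "poset_points P = usc_maps P // usc_equiv P"

definition poset_dist :: "(real \<Rightarrow> 'a) set \<Rightarrow> (real \<Rightarrow> 'a) set \<Rightarrow> real" where
  "poset_dist F G = usc_dist (SOME f. f \<in> F) (SOME g. g \<in> G)"

definition poset_real :: "'a rel \<Rightarrow> (real \<Rightarrow> 'a) set topology" where
  "poset_real P = Metric_space.mtopology (poset_points P) poset_dist"

definition poset_real_map ::
  "'b rel \<Rightarrow> ('a \<Rightarrow> 'b) \<Rightarrow> (real \<Rightarrow> 'a) set \<Rightarrow> (real \<Rightarrow> 'b) set" where
  "poset_real_map Q h F = (\<Union>f\<in>F. usc_equiv Q `` {compose {0..1} h f})"

lemma usc_dist_integrable: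
  assumes P: "finite_poset P" and f: "f \<in> usc_maps P" and g: "g \<in> usc_maps P"
  shows "(\<lambda>t. discrete_metric.dd (f t) (g t)) integrable_on {0..1}"
proof -
  have fin: "finite (Field P)" and anti: "antisym P"
    using P by (auto simp: finite_poset_def partial_order_on_def)
  define A where "A p = {t \<in> {0..1}. f t = p \<and> g t = p}" for p
  have mono: "(k s, k t) \<in> P" if "k \<in> usc_maps P" "0 \<le> s" "s \<le> t" "t \<le> 1" for k s t
    using that by (auto simp: usc_maps_def order_maps_def unit_interval_def)
  have "is_interval (A p)" for p
    unfolding is_interval_1
  proof (intro ballI allI impI)
    fix s u t
    assume "s \<in> A p" "u \<in> A p" and t: "s \<le> t \<and> t \<le> u"
    then have su: "0 \<le> s" "u \<le> 1" "f s = p" "g s = p" "f u = p" "g u = p"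
      by (auto simp: A_def)
    then have "(p, f t) \<in> P" "(f t, p) \<in> P" "(p, g t) \<in> P" "(g t, p) \<in> P"
      using mono[OF f, of s t] mono[OF f, of t u] mono[OF g, of s t] mono[OF g, of t u] t by auto
    then show "t \<in> A p"
      using antisymD[OF anti] su t by (auto simp: A_def)
  qed
  then have "A p \<in> lmeasurable" for p
    by (intro measurable_convex is_interval_convex)
       (auto simp: A_def intro: bounded_subset[OF bounded_closed_interval, of _ 0 1])
  then have "indicat_real (A p) integrable_on {0..1}" for p
    by (simp add: integrable_on_indicator fmeasurable_Int_fmeasurable)
  then have int: "(\<lambda>t. 1 - (\<Sum>p\<in>Field P. indicat_real (A p) t)) integrable_on {0..1}"
    by (intro integrable_diff integrable_sum fin) auto
  have "1 - (\<Sum>p\<in>Field P. indicat_real (A p) t) = discrete_metric.dd (f t) (g t)"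
    if t: "t \<in> {0..1}" for t
  proof -
    have "f t \<in> Field P"
      using t f by (auto simp: usc_maps_def order_maps_def)
    have "(\<Sum>p\<in>Field P. indicat_real (A p) t) = (\<Sum>p\<in>Field P. if p = f t \<and> f t = g t then 1 else 0)"
      using t by (intro sum.cong) (auto simp: A_def indicator_def)
    also have "\<dots> = (if f t = g t then 1 else 0)"
      using fin \<open>f t \<in> Field P\<close> by (cases "f t = g t") auto
    finally show ?thesis
      by (simp add: discrete_metric.dd_def)
  qed
  then show ?thesis
    by (rule integrable_eq[OF int])
qed

lemma usc_dist_commute: "usc_dist f g = usc_dist g f"
  unfolding usc_dist_def discrete_metric.dd_def by (simp add: eq_commute)

lemma usc_dist_self [simp]: "usc_dist f f = 0"
  unfolding usc_dist_def discrete_metric.dd_def by simp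

lemma usc_dist_nonneg: "0 \<le> usc_dist f g"
proof (cases "(\<lambda>t. discrete_metric.dd (f t) (g t)) integrable_on {0..1}")
  case True
  then show ?thesis
    unfolding usc_dist_def by (intro integral_nonneg) (auto simp: discrete_metric.dd_def)
qed (simp add: usc_dist_def not_integrable_integral)

lemma usc_dist_triangle:
  assumes "finite_poset P" "f \<in> usc_maps P" "g \<in> usc_maps P" "h \<in> usc_maps P"
  shows "usc_dist f h \<le> usc_dist f g + usc_dist g h"
proof -
  note I = usc_dist_integrable[OF assms(1)]
  have "integral {0..1} (\<lambda>t. discrete_metric.dd (f t) (h t)) \<le>
      integral {0..1} (\<lambda>t. discrete_metric.dd (f t) (g t) + discrete_metric.dd (g t) (h t))"
    by (intro integral_le integrable_add I assms) (simp add: discrete_metric.dd_def)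
  also have "\<dots> = usc_dist f g + usc_dist g h"
    unfolding usc_dist_def by (intro integral_add I assms)
  finally show ?thesis
    unfolding usc_dist_def[of f h] .
qed

lemma equiv_usc_equiv:
  assumes P: "finite_poset P"
  shows "equiv (usc_maps P) (usc_equiv P)"
proof (intro equivI transI)
  fix f g h
  assume "(f, g) \<in> usc_equiv P" "(g, h) \<in> usc_equiv P"
  then show "(f, h) \<in> usc_equiv P"
    using usc_dist_triangle[OF P, of f g h] usc_dist_nonneg[of f h]
    by (auto simp: usc_equiv_def)
qed (auto simp: usc_equiv_def refl_on_def sym_def usc_dist_commute)

lemma poset_dist_class:
  assumes P: "finite_poset P" and f: "f \<in> usc_maps P" and g: "g \<in> usc_maps P"
  shows "poset_dist (usc_equiv P `` {f}) (usc_equiv P `` {g}) = usc_dist f g"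
proof -
  define f' where "f' = (SOME f'. f' \<in> usc_equiv P `` {f})"
  define g' where "g' = (SOME g'. g' \<in> usc_equiv P `` {g})"
  have "(f, f) \<in> usc_equiv P" "(g, g) \<in> usc_equiv P"
    using f g by (auto simp: usc_equiv_def)
  then have "f \<in> usc_equiv P `` {f}" "g \<in> usc_equiv P `` {g}"
    by auto
  then have "f' \<in> usc_equiv P `` {f}" "g' \<in> usc_equiv P `` {g}"
    unfolding f'_def g'_def some_in_eq by blast+
  then have "f' \<in> usc_maps P" "usc_dist f f' = 0" "g' \<in> usc_maps P" "usc_dist g g' = 0"
    by (auto simp: usc_equiv_def)
  then have "usc_dist f' g' = usc_dist f g"
    using f g usc_dist_triangle[OF P, of f f' g] usc_dist_triangle[OF P, of f' g' g]
      usc_dist_triangle[OF P, of f' f g'] usc_dist_triangle[OF P, of f g g']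
      usc_dist_commute[of f f'] usc_dist_commute[of g g'] by linarith
  then show ?thesis
    unfolding poset_dist_def f'_def g'_def .
qed

lemma Metric_space_poset_real:
  assumes P: "finite_poset P"
  shows "Metric_space (poset_points P) poset_dist"
proof
  have rep: "\<exists>f\<in>usc_maps P. F = usc_equiv P `` {f}" if "F \<in> poset_points P" for F
    using that by (auto simp: poset_points_def quotient_def)
  fix F G H :: "(real \<Rightarrow> 'a) set"
  show "0 \<le> poset_dist F G" "poset_dist F G = poset_dist G F"
    by (simp_all add: poset_dist_def usc_dist_nonneg usc_dist_commute)
  assume F: "F \<in> poset_points P" and G: "G \<in> poset_points P"
  obtain f g where f: "f \<in> usc_maps P" "F = usc_equiv P `` {f}"
    and g: "g \<in> usc_maps P" "G = usc_equiv P `` {g}"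
    using rep[OF F] rep[OF G] by auto
  have "F = G \<longleftrightarrow> (f, g) \<in> usc_equiv P"
    unfolding f g using f g by (intro eq_equiv_class_iff[OF equiv_usc_equiv[OF P]])
  then show "poset_dist F G = 0 \<longleftrightarrow> F = G"
    unfolding f g poset_dist_class[OF P f(1) g(1)] using f g by (simp add: usc_equiv_def)
  assume "H \<in> poset_points P"
  then obtain h where h: "h \<in> usc_maps P" "H = usc_equiv P `` {h}"
    using rep by auto
  show "poset_dist F H \<le> poset_dist F G + poset_dist G H"
    unfolding f g h poset_dist_class[OF P f(1) g(1)] poset_dist_class[OF P f(1) h(1)]
      poset_dist_class[OF P g(1) h(1)]
    by (intro usc_dist_triangle[OF P] f g h)
qed

lemma usc_dist_zero_not_eq:
  assumes P: "finite_poset P" and pq: "(q, p) \<in> P" "q \<noteq> p"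
  defines "f \<equiv> \<lambda>t\<in>{0..1::real}. if t = 1 then p else q" and "g \<equiv> \<lambda>t\<in>{0..1::real}. q"
  shows "f \<in> usc_maps P" "g \<in> usc_maps P" "f \<noteq> g" "usc_dist f g = 0"
proof -
  have "refl_on (Field P) P" "antisym P"
    using P by (auto simp: finite_poset_def partial_order_onD)
  then have q: "q \<in> Field P" "p \<in> Field P" "(q, q) \<in> P" "(p, p) \<in> P" "(p, q) \<notin> P"
    using pq FieldI1[OF pq(1)] FieldI2[OF pq(1)] by (auto simp: refl_on_def antisym_def)
  have "{t \<in> {0..1}. (p, f t) \<in> P} = {1}" "{t \<in> {0..1}. (q, f t) \<in> P} = {0..1}"
    "{t \<in> {0..1}. (q, g t) \<in> P} = {0..1}"
    using q pq by (auto simp: f_def g_def)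
  moreover have "f ` {0..1} \<subseteq> {p, q}" "g ` {0..1} \<subseteq> {q}"
    by (auto simp: f_def g_def)
  moreover have "f \<in> order_maps unit_interval P" "g \<in> order_maps unit_interval P"
    using q pq unfolding order_maps_def Field_unit_interval
    by (auto simp: unit_interval_def f_def g_def)
  ultimately show "f \<in> usc_maps P" "g \<in> usc_maps P"
    unfolding usc_maps_def by (auto simp: subset_iff simp del: atLeastAtMost_iff)
  have "f 1 \<noteq> g 1"
    using pq by (simp add: f_def g_def)
  then show "f \<noteq> g" by auto
  have "((\<lambda>t. discrete_metric.dd (f t) (g t)) has_integral 0) {0..1}"
    by (rule has_integral_spike_finite[of "{1}" _ _ "\<lambda>_. 0"])
       (auto simp: f_def g_def discrete_metric.dd_def)
  then show "usc_dist f g = 0"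
    by (simp add: usc_dist_def integral_unique)
qed

end

theory Submission
  imports Defs
begin

text \<open>A point \<open>x\<close> of the simplex indexed by \<open>\<sigma> : [n] \<rightarrow> P\<close> gives the path
  that stays for time \<open>x i\<close> at \<open>\<sigma> i\<close>, for \<open>i = 0, \<dots>, n\<close>.  The time that this path spends at
  \<open>p\<close> is the weight \<open>\<Sum>{x i. \<sigma> i = p}\<close>.  Weights are invariant under gluing, and they determine
  both a point of \<open>|S(P)|\<close> (through the nondegenerate simplex on their support) and a point of \<open>|P|\<close>
  (since a path traverses a chain in increasing order).  Hence the induced map \<open>|S(P)| \<rightarrow> |P|\<close> is a
  natural bijection.  It is continuous on each simplex, and \<open>|S(P)|\<close> is compact, being covered by
  finitely many simplices, so it is a homeomorphism onto the metric space \<open>|P|\<close>.\<close>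

section \<open>Occupation times of paths in a poset\<close>

text \<open>Two features shape the argument. Upper semi-continuity makes a path right-continuous, so
  every value taken before time 1 is held for a positive time and shows up in the weights. The value
  at time 1 alone may leave no trace, which is exactly the ambiguity removed by passing to classes
  at distance 0. On the simplicial side gluing is only a generating relation, whose equivalence
  closure consists of zigzags. Weights replace an analysis of zigzags: invariance has to be checked
  on a single generator, and two points with equal weights are joined through explicit simplices.
  The comparison is built from \<open>|S(P)|\<close> to \<open>|P|\<close> because a map out of a
  quotient of a disjoint union can be defined and proved continuous simplex by simplex, while
  continuity of the inverse then needs no description of neighbourhoods in
  \<open>|S(P)|\<close>.\<close>

lemma has_integral_of_bool_ge:
  assumes "0 \<le> a" "a \<le> 1"
  shows "((\<lambda>t::real. of_bool (a \<le> t) :: real) has_integral 1 - a) {0..1}"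
proof -
  have "((\<lambda>_. 1 :: real) has_integral 1 - a) {a..1}"
    using has_integral_const_real[of "1::real" a 1] assms by simp
  then have "((\<lambda>t. if t \<in> {a..1} then 1 else 0 :: real) has_integral 1 - a) {0..1}"
    using assms by (subst has_integral_restrict) auto
  then show ?thesis
    by (rule has_integral_eq[rotated]) auto
qed

lemma has_integral_of_bool_le:
  assumes "0 \<le> a" "a \<le> 1"
  shows "((\<lambda>t::real. of_bool (t \<le> a) :: real) has_integral a) {0..1}"
proof -
  have "((\<lambda>_. 1 :: real) has_integral a) {0..a}"
    using has_integral_const_real[of "1::real" 0 a] assms by simp
  then have "((\<lambda>t. if t \<in> {0..a} then 1 else 0 :: real) has_integral a) {0..1}"
    using assms by (subst has_integral_restrict) auto
  then show ?thesis
    by (rule has_integral_eq[rotated]) auto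
qed

lemma finite_posetD:
  assumes "finite_poset P"
  shows "finite (Field P)" "refl_on (Field P) P" "trans P" "antisym P"
  using assms by (auto simp: finite_poset_def order_on_defs)

lemma usc_maps_mono:
  assumes "f \<in> usc_maps P" "0 \<le> s" "s \<le> t" "t \<le> 1"
  shows "(f s, f t) \<in> P"
  using assms by (auto simp: usc_maps_def order_maps_def unit_interval_def)

lemma usc_maps_in_Field:
  assumes "f \<in> usc_maps P" "0 \<le> t" "t \<le> 1"
  shows "f t \<in> Field P"
  using usc_maps_mono[OF assms(1,2) order.refl assms(3)] by (auto simp: Field_def)

lemma constant_in_usc_maps:
  assumes "finite_poset P" "p \<in> Field P"
  shows "(\<lambda>t\<in>{0..1}. p) \<in> usc_maps P"
proof -
  have "(p, p) \<in> P"
    using assms(2) finite_posetD(2)[OF assms(1)] by (auto simp: refl_on_def)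
  moreover from this have "{t \<in> {0..1}. (p, (\<lambda>t\<in>{0..1}. p) t) \<in> P} = {0..1::real}"
    by auto
  moreover have "(\<lambda>t\<in>{0..1}. p) \<in> order_maps unit_interval P"
    using assms(2) calculation(1) unfolding order_maps_def Field_unit_interval
    by (auto simp: unit_interval_def)
  ultimately show ?thesis
    by (auto simp: usc_maps_def simp del: atLeastAtMost_iff)
qed

text \<open>The Lebesgue measure of \<open>{t. f t = p}\<close>; expressing it as a distance makes its
  invariance under \<^const>\<open>usc_equiv\<close> an instance of the triangle inequality.\<close>

definition mass :: "(real \<Rightarrow> 'a) \<Rightarrow> 'a \<Rightarrow> real" where
  "mass f p = 1 - usc_dist f (\<lambda>t\<in>{0..1}. p)"

text \<open>Subtracting from 1 turns the discrete distance to a constant path into the indicator of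
  \<open>f t = p\<close>; integrability is inherited from
  \<open>usc_dist_integrable\<close>.\<close>

lemma has_integral_mass:
  assumes "finite_poset P" "f \<in> usc_maps P" "p \<in> Field P"
  shows "((\<lambda>t. of_bool (f t = p)) has_integral mass f p) {0..1}"
proof -
  have "((\<lambda>t. discrete_metric.dd (f t) ((\<lambda>t\<in>{0..1}. p) t)) has_integral
      usc_dist f (\<lambda>t\<in>{0..1}. p)) {0..1}"
    unfolding usc_dist_def
    using usc_dist_integrable[OF assms(1,2) constant_in_usc_maps[OF assms(1,3)]]
    by (rule integrable_integral)
  moreover have "((\<lambda>_. 1 :: real) has_integral 1) {0..1::real}"
    using has_integral_const_real[of "1::real" 0 1] by simp
  ultimately have "((\<lambda>t. 1 - discrete_metric.dd (f t) ((\<lambda>t\<in>{0..1}. p) t)) has_integral mass f p) {0..1}"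
    unfolding mass_def by (intro has_integral_diff)
  then show ?thesis
    by (rule has_integral_eq[rotated]) (auto simp: discrete_metric.dd_def)
qed

lemma has_integral_sum_mass:
  assumes "finite_poset P" "f \<in> usc_maps P" "A \<subseteq> Field P"
  shows "((\<lambda>t. of_bool (f t \<in> A)) has_integral (\<Sum>p\<in>A. mass f p)) {0..1}"
proof -
  have fin: "finite A"
    using assms finite_posetD(1) finite_subset by blast
  have "((\<lambda>t. \<Sum>p\<in>A. of_bool (f t = p)) has_integral (\<Sum>p\<in>A. mass f p)) {0..1}"
    using assms fin by (intro has_integral_sum has_integral_mass) auto
  moreover have "(\<Sum>p\<in>A. of_bool (f t = p)) = (of_bool (f t \<in> A) :: real)" for t
    using fin by (simp add: of_bool_def)
  ultimately show ?thesis by simp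
qed

lemma mass_nonneg:
  assumes "finite_poset P" "f \<in> usc_maps P" "p \<in> Field P"
  shows "0 \<le> mass f p"
  using has_integral_nonneg[OF has_integral_mass[OF assms]] by simp

text \<open>Used in contrapositive form: a point of positive mass is a value of the path, hence
  comparable with all other values.\<close>

lemma mass_eq_0:
  assumes "finite_poset P" "f \<in> usc_maps P" "p \<in> Field P" "p \<notin> f ` {0..1}"
  shows "mass f p = 0"
proof -
  have "((\<lambda>_. 0 :: real) has_integral mass f p) {0..1::real}"
    using has_integral_mass[OF assms(1-3)]
    by (rule has_integral_eq[rotated]) (use assms(4) in auto)
  then show ?thesis
    by (simp add: has_integral_0_eq)
qed

lemma sum_mass:
  assumes "finite_poset P" "f \<in> usc_maps P"
  shows "(\<Sum>p\<in>Field P. mass f p) = 1"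
proof -
  have "((\<lambda>_. 1 :: real) has_integral (\<Sum>p\<in>Field P. mass f p)) {0..1::real}"
    using has_integral_sum_mass[OF assms order.refl]
    by (rule has_integral_eq[rotated]) (simp add: usc_maps_in_Field[OF assms(2)])
  moreover have "((\<lambda>_. 1 :: real) has_integral 1) {0..1::real}"
    using has_integral_const_real[of "1::real" 0 1] by simp
  ultimately show ?thesis
    by (rule has_integral_unique)
qed

lemma mass_cong:
  assumes P: "finite_poset P" and fg: "f \<in> usc_maps P" "g \<in> usc_maps P" and p: "p \<in> Field P"
    and "usc_dist f g = 0"
  shows "mass f p = mass g p"
  using usc_dist_triangle[OF P fg constant_in_usc_maps[OF P p]]
    usc_dist_triangle[OF P fg(2,1) constant_in_usc_maps[OF P p]]
    usc_dist_commute[of f g] assms(5)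
  unfolding mass_def by linarith

text \<open>After \<open>t\<close> the path takes finitely many values, which form a chain and so
  have a least one. The superlevel set of that value is closed and contains everything after
  \<open>t\<close>, hence also \<open>t\<close> itself.\<close>

lemma usc_maps_right_constant:
  assumes P: "finite_poset P" and f: "f \<in> usc_maps P" and t: "0 \<le> t" "t < 1"
  obtains s where "t < s" "s \<le> 1" "f s = f t"
proof -
  define below where "below s = {q. (q, f s) \<in> P}" for s
  \<comment> \<open>The down-sets of the values are nested along the path, so the smallest one
    belongs to the least value taken after \<open>t\<close>. Counting its elements replaces a
    minimum in \<open>P\<close> by one in the natural numbers.\<close>
  define s where "s = (ARG_MIN (\<lambda>s. card (below s)) s. t < s \<and> s \<le> 1)"
  have fin: "finite (below s)" for s
    using finite_posetD(1)[OF P] by (rule finite_subset[rotated]) (auto simp: below_def Field_def)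
  have "t < s \<and> s \<le> 1" and le: "card (below s) \<le> card (below u)" if "t < u" "u \<le> 1" for u
    using arg_min_natI[of "\<lambda>s. t < s \<and> s \<le> 1" 1] t
      arg_min_nat_le[of "\<lambda>s. t < s \<and> s \<le> 1" u "\<lambda>s. card (below s)"] that
    unfolding s_def by auto
  then have s: "t < s" "s \<le> 1"
    using t by auto
  have least: "(f s, f u) \<in> P" if u: "t < u" "u \<le> 1" for u
  proof (cases "s \<le> u")
    case True
    then show ?thesis using usc_maps_mono[OF f, of s u] s t u by simp
  next
    case False
    then have us: "(f u, f s) \<in> P"
      using usc_maps_mono[OF f, of u s] s t u by simp
    then have "below u \<subseteq> below s"
      using finite_posetD(3)[OF P] by (auto simp: below_def dest: transD)
    then have "below u = below s"
      using le[OF u] fin by (metis card_seteq)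
    moreover have "f s \<in> below s"
      using finite_posetD(2)[OF P] us by (auto simp: below_def refl_on_def Field_def)
    ultimately show ?thesis by (auto simp: below_def)
  qed
  define K where "K = {u \<in> {0..1}. (f s, f u) \<in> P}"
  have "closed K"
    using f s t unfolding usc_maps_def K_def by auto
  moreover have "{t<..1} \<subseteq> K"
    using least t by (auto simp: K_def)
  ultimately have "closure {t<..1} \<subseteq> K"
    by (simp add: closure_minimal)
  then have "t \<in> K"
    using t by auto
  then have "(f s, f t) \<in> P"
    by (simp add: K_def)
  moreover have "(f t, f s) \<in> P"
    using usc_maps_mono[OF f, of t s] s t by simp
  ultimately have "f s = f t"
    using finite_posetD(4)[OF P] by (auto dest: antisymD)
  then show thesis
    using that s by blast
qed

text \<open>The value at \<open>t\<close> can be read off the masses: it is the \<open>p\<close> in the support of \<^term>\<open>mass f\<close>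
  for which \<open>t\<close> lies between the masses strictly below \<open>p\<close> and weakly below \<open>p\<close>.\<close>

lemma mass_bounds:
  assumes P: "finite_poset P" and f: "f \<in> usc_maps P" and t: "0 \<le> t" "t < 1"
  shows "(\<Sum>q | (q, f t) \<in> P \<and> q \<noteq> f t. mass f q) \<le> t"
    and "t < (\<Sum>q | (q, f t) \<in> P. mass f q)"
    and "0 < mass f (f t)"
proof -
  note anti = antisymD[OF finite_posetD(4)[OF P]]
  obtain s where s: "t < s" "s \<le> 1" "f s = f t"
    using usc_maps_right_constant[OF P f t] .
  have sub: "{q. (q, f t) \<in> P} \<subseteq> Field P" "{q. (q, f t) \<in> P \<and> q \<noteq> f t} \<subseteq> Field P"
    by (auto simp: Field_def)
  show "(\<Sum>q | (q, f t) \<in> P \<and> q \<noteq> f t. mass f q) \<le> t"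
  proof (rule has_integral_le[OF has_integral_sum_mass[OF P f sub(2)] has_integral_of_bool_le])
    fix u :: real assume u: "u \<in> {0..1}"
    show "of_bool (f u \<in> {q. (q, f t) \<in> P \<and> q \<noteq> f t}) \<le> (of_bool (u \<le> t) :: real)"
      using usc_maps_mono[OF f, of t u] anti u t by (cases "u \<le> t") auto
  qed (use t in auto)
  \<comment> \<open>The bound is proved at \<open>s\<close> instead of \<open>t\<close>, using
    \<open>f s = f t\<close>; this makes the inequality for \<open>t\<close> strict.\<close>
  have "s \<le> (\<Sum>q | (q, f t) \<in> P. mass f q)"
  proof (rule has_integral_le[OF has_integral_of_bool_le has_integral_sum_mass[OF P f sub(1)]])
    fix u :: real assume u: "u \<in> {0..1}"
    show "of_bool (u \<le> s) \<le> (of_bool (f u \<in> {q. (q, f t) \<in> P}) :: real)"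
      using usc_maps_mono[OF f, of u s] u s by (cases "u \<le> s") auto
  qed (use t s in auto)
  then show "t < (\<Sum>q | (q, f t) \<in> P. mass f q)"
    using s by simp
  \<comment> \<open>The path is constant on \<open>[t, s)\<close>, whose indicator is the difference
    of two threshold indicators.\<close>
  have "(1 - t) - (1 - s) \<le> mass f (f t)"
  proof (rule has_integral_le[OF has_integral_diff has_integral_mass[OF P f]])
    show "((\<lambda>u. of_bool (t \<le> u)) has_integral 1 - t) {0..1}"
      "((\<lambda>u. of_bool (s \<le> u)) has_integral 1 - s) {0..1}"
      using s t by (auto intro!: has_integral_of_bool_ge)
    show "f t \<in> Field P"
      using usc_maps_in_Field[OF f] t by simp
    fix u :: real assume u: "u \<in> {0..1}"
    show "of_bool (t \<le> u) - of_bool (s \<le> u) \<le> (of_bool (f u = f t) :: real)"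
      using usc_maps_mono[OF f, of t u] usc_maps_mono[OF f, of u s] anti u s t
      by (cases "t \<le> u"; cases "s \<le> u") auto
  qed
  then show "0 < mass f (f t)"
    using s by simp
qed

text \<open>At a time \<open>t < 1\<close> the value \<open>g t\<close> has positive mass for
  \<open>f\<close> too, so it is a value of \<open>f\<close> and comparable with \<open>f t\<close>.
  If one were strictly below the other, the lower bound of \<open>mass_bounds\<close> for the larger
  value and the upper bound for the smaller one would give \<open>t < t\<close>.\<close>

lemma usc_dist_eq_0_if_mass_eq:
  assumes P: "finite_poset P" and f: "f \<in> usc_maps P" and g: "g \<in> usc_maps P"
    and eq: "\<And>p. p \<in> Field P \<Longrightarrow> mass f p = mass g p"
  shows "usc_dist f g = 0"
proof -
  have not_below: "(f t, g t) \<notin> P \<or> f t = g t"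
    if f: "f \<in> usc_maps P" and g: "g \<in> usc_maps P"
      and eq: "\<And>p. p \<in> Field P \<Longrightarrow> mass f p = mass g p" and t: "0 \<le> t" "t < 1" for f g t
  proof (rule ccontr)
    assume "\<not> ?thesis"
    then have lt: "(f t, g t) \<in> P" "f t \<noteq> g t" by auto
    have "t < (\<Sum>q | (q, f t) \<in> P. mass f q)"
      using mass_bounds(2)[OF P f t] .
    also have "\<dots> = (\<Sum>q | (q, f t) \<in> P. mass g q)"
      by (intro sum.cong eq) (auto simp: Field_def)
    also have "\<dots> \<le> (\<Sum>q | (q, g t) \<in> P \<and> q \<noteq> g t. mass g q)"
    proof (rule sum_mono2)
      show "finite {q. (q, g t) \<in> P \<and> q \<noteq> g t}"
        using finite_posetD(1)[OF P] by (rule finite_subset[rotated]) (auto simp: Field_def)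
      show "{q. (q, f t) \<in> P} \<subseteq> {q. (q, g t) \<in> P \<and> q \<noteq> g t}"
        using lt finite_posetD(3,4)[OF P] by (auto dest: transD antisymD)
      show "0 \<le> mass g q" if "q \<in> {q. (q, g t) \<in> P \<and> q \<noteq> g t} - {q. (q, f t) \<in> P}" for q
        using that by (intro mass_nonneg[OF P g]) (auto simp: Field_def)
    qed
    also have "\<dots> \<le> t"
      using mass_bounds(1)[OF P g t] .
    finally show False by simp
  qed
  have same: "f t = g t" if t: "0 \<le> t" "t < 1" for t
  proof -
    have "0 < mass f (g t)"
      using mass_bounds(3)[OF P g t] eq usc_maps_in_Field[OF g] t by simp
    then obtain s where s: "0 \<le> s" "s \<le> 1" "g t = f s"
      using mass_eq_0[OF P f, of "g t"] usc_maps_in_Field[OF g, of t] t by force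
    then have "(f t, g t) \<in> P \<or> (g t, f t) \<in> P"
      using usc_maps_mono[OF f, of s t] usc_maps_mono[OF f, of t s] t by (cases "s \<le> t") auto
    then show ?thesis
      using not_below[OF f g eq t] not_below[OF g f eq[symmetric] t] by auto
  qed
  \<comment> \<open>The masses do not determine the value at time 1, but a single point does not
    affect the integral.\<close>
  have "((\<lambda>t. discrete_metric.dd (f t) (g t)) has_integral 0) {0..1}"
    by (rule has_integral_spike_finite[of "{1}" _ _ "\<lambda>_. 0"])
       (auto simp: same discrete_metric.dd_def)
  then show ?thesis
    by (simp add: usc_dist_def integral_unique)
qed

section \<open>The path of a point of a simplex\<close>

lemma standard_simplexD:
  assumes "x \<in> standard_simplex n"
  shows "0 \<le> x i" "(\<Sum>i\<le>n. x i) = 1"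
  using assms by (auto simp: standard_simplex_def)

text \<open>The sum excludes \<open>k\<close>, so this is the left end of the \<open>k\<close>-th
  interval, and \<open>k = Suc n\<close> gives the right end 1 of the last one.\<close>

definition partial_sum :: "(nat \<Rightarrow> real) \<Rightarrow> nat \<Rightarrow> real" where
  "partial_sum x k = (\<Sum>i<k. x i)"

lemma partial_sum_0 [simp]: "partial_sum x 0 = 0"
  by (simp add: partial_sum_def)

lemma partial_sum_Suc: "partial_sum x (Suc k) = partial_sum x k + x k"
  by (simp add: partial_sum_def)

lemma partial_sum_mono:
  assumes "x \<in> standard_simplex n" "j \<le> k"
  shows "partial_sum x j \<le> partial_sum x k"
  unfolding partial_sum_def
  by (rule sum_mono2) (use assms standard_simplexD(1)[OF assms(1)] in auto)

lemma partial_sum_last: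
  assumes "x \<in> standard_simplex n"
  shows "partial_sum x (Suc n) = 1"
  using standard_simplexD(2)[OF assms] by (simp add: partial_sum_def lessThan_Suc_atMost)

lemma partial_sum_bounds:
  assumes "x \<in> standard_simplex n" "k \<le> Suc n"
  shows "0 \<le> partial_sum x k" "partial_sum x k \<le> 1"
  using partial_sum_mono[OF assms(1), of 0 k] partial_sum_mono[OF assms]
    partial_sum_last[OF assms(1)] by auto

text \<open>A point \<open>x\<close> of the simplex divides \<open>[0,1]\<close> into \<open>n + 1\<close> consecutive intervals of lengths
  \<open>x 0, \<dots>, x n\<close>; \<open>locate n x t\<close> is the index of the one containing \<open>t\<close>.\<close>

definition locate :: "nat \<Rightarrow> (nat \<Rightarrow> real) \<Rightarrow> real \<Rightarrow> nat" where
  "locate n x t = Max {k \<in> {..n}. partial_sum x k \<le> t}"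

lemma locate_le:
  assumes "0 \<le> t"
  shows "locate n x t \<le> n"
proof -
  have "0 \<in> {k \<in> {..n}. partial_sum x k \<le> t}"
    using assms by simp
  then have "locate n x t \<in> {k \<in> {..n}. partial_sum x k \<le> t}"
    unfolding locate_def by (intro Max_in) auto
  then show ?thesis by simp
qed

text \<open>A Galois connection between indices and times, the source of all later facts on
  \<open>locate\<close> beyond its range. The bound \<open>k \<le> n\<close> matters at
  \<open>t = 1\<close>, where \<open>partial_sum x (Suc n) \<le> t\<close> holds although
  \<open>locate\<close> never exceeds \<open>n\<close>.\<close>

lemma le_locate_iff:
  assumes x: "x \<in> standard_simplex n" and "0 \<le> t" "k \<le> n"
  shows "k \<le> locate n x t \<longleftrightarrow> partial_sum x k \<le> t"
proof -
  have "0 \<in> {k \<in> {..n}. partial_sum x k \<le> t}"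
    using assms by simp
  then have "k \<le> locate n x t \<longleftrightarrow> (\<exists>j\<in>{k \<in> {..n}. partial_sum x k \<le> t}. k \<le> j)"
    unfolding locate_def by (intro Max_ge_iff) auto
  then show ?thesis
    using assms(3) partial_sum_mono[OF x, of k] by fastforce
qed

lemma locate_mono:
  assumes "x \<in> standard_simplex n" "0 \<le> s" "s \<le> t"
  shows "locate n x s \<le> locate n x t"
  using le_locate_iff[OF assms(1), of s "locate n x s"] le_locate_iff[OF assms(1), of t "locate n x s"]
    locate_le[of s n x] assms by auto

definition cell_path :: "nat \<Rightarrow> (nat \<Rightarrow> 'a) \<Rightarrow> (nat \<Rightarrow> real) \<Rightarrow> real \<Rightarrow> 'a" where
  "cell_path n \<sigma> x = (\<lambda>t\<in>{0..1}. \<sigma> (locate n x t))"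

lemma order_maps_ordinalD:
  assumes "\<sigma> \<in> order_maps (ordinal n) P"
  shows "\<sigma> \<in> extensional {..n}" "i \<le> n \<Longrightarrow> \<sigma> i \<in> Field P"
    "i \<le> j \<Longrightarrow> j \<le> n \<Longrightarrow> (\<sigma> i, \<sigma> j) \<in> P"
  using assms unfolding order_maps_def Field_ordinal by (auto simp: ordinal_def PiE_iff)

lemma order_maps_ordinalI:
  assumes "\<sigma> \<in> extensional {..n}" "\<And>i j. i \<le> j \<Longrightarrow> j \<le> n \<Longrightarrow> (\<sigma> i, \<sigma> j) \<in> P"
  shows "\<sigma> \<in> order_maps (ordinal n) P"
proof -
  have "\<sigma> i \<in> Field P" if "i \<le> n" for i
    using assms(2)[OF order.refl that] by (rule FieldI1)
  then show ?thesis
    unfolding order_maps_def Field_ordinal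
    using assms by (simp add: ordinal_def PiE_iff)
qed

text \<open>Taking the maximum in \<open>locate\<close> puts each division point into the interval
  to its right. The times with value above \<open>p\<close> therefore form a finite union of closed
  intervals, one starting at \<open>partial_sum x k\<close> for each \<open>k\<close> with
  \<open>\<sigma> k\<close> above \<open>p\<close>.\<close>

lemma cell_path_in_usc_maps:
  assumes P: "finite_poset P" and \<sigma>: "\<sigma> \<in> order_maps (ordinal n) P" and x: "x \<in> standard_simplex n"
  shows "cell_path n \<sigma> x \<in> usc_maps P"
proof -
  have "cell_path n \<sigma> x \<in> order_maps unit_interval P"
    unfolding order_maps_def Field_unit_interval
    using order_maps_ordinalD[OF \<sigma>] locate_le[of _ n x] locate_mono[OF x]
    by (auto simp: unit_interval_def cell_path_def)
  moreover have "closed {t \<in> {0..1}. (p, cell_path n \<sigma> x t) \<in> P}" for p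
  proof -
    have "(p, \<sigma> (locate n x t)) \<in> P \<longleftrightarrow> (\<exists>k\<in>{k\<in>{..n}. (p, \<sigma> k) \<in> P}. partial_sum x k \<le> t)"
      if t: "0 \<le> t" for t
    proof
      assume "(p, \<sigma> (locate n x t)) \<in> P"
      then show "\<exists>k\<in>{k\<in>{..n}. (p, \<sigma> k) \<in> P}. partial_sum x k \<le> t"
        using locate_le[OF t, of n x] le_locate_iff[OF x t, of "locate n x t"] by auto
    next
      assume "\<exists>k\<in>{k\<in>{..n}. (p, \<sigma> k) \<in> P}. partial_sum x k \<le> t"
      then obtain k where k: "k \<le> n" "(p, \<sigma> k) \<in> P" "partial_sum x k \<le> t" by auto
      then have "(\<sigma> k, \<sigma> (locate n x t)) \<in> P"
        using order_maps_ordinalD(3)[OF \<sigma>] le_locate_iff[OF x t] locate_le[OF t] by auto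
      then show "(p, \<sigma> (locate n x t)) \<in> P"
        using k(2) finite_posetD(3)[OF P] by (auto dest: transD)
    qed
    then have "{t \<in> {0..1}. (p, cell_path n \<sigma> x t) \<in> P} =
        (\<Union>k\<in>{k\<in>{..n}. (p, \<sigma> k) \<in> P}. {0..1} \<inter> {partial_sum x k..})"
      by (auto simp: cell_path_def)
    moreover have "closed (\<Union>k\<in>{k\<in>{..n}. (p, \<sigma> k) \<in> P}. {0..1} \<inter> {partial_sum x k..})"
      by (intro closed_UN closed_Int) auto
    ultimately show ?thesis by simp
  qed
  ultimately show ?thesis
    unfolding usc_maps_def by blast
qed

text \<open>Composition with \<open>h\<close> relabels the cells and leaves the division points
  alone. Naturality rests on this being an equation of paths, not merely of classes.\<close>

lemma compose_cell_path:
  "compose {0..1} h (cell_path n \<sigma> x) = cell_path n (compose {..n} h \<sigma>) x"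
  using locate_le[of _ n x] by (auto simp: compose_def cell_path_def fun_eq_iff)

text \<open>The case \<open>k = Suc n\<close>, where integrand and integral vanish, is included so
  that the last cell can be treated as a difference like all others.\<close>

lemma has_integral_locate_ge:
  assumes x: "x \<in> standard_simplex n" and k: "k \<le> Suc n"
  shows "((\<lambda>t. of_bool (k \<le> locate n x t)) has_integral 1 - partial_sum x k) {0..1}"
proof (cases "k = Suc n")
  case True
  have "((\<lambda>_. 0 :: real) has_integral 1 - partial_sum x k) {0..1::real}"
    unfolding True partial_sum_last[OF x] by simp
  then show ?thesis
    by (rule has_integral_eq[rotated]) (simp add: True locate_le not_less_eq_eq)
next
  case False
  have "((\<lambda>t::real. of_bool (partial_sum x k \<le> t) :: real) has_integral 1 - partial_sum x k) {0..1}"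
    using partial_sum_bounds[OF assms] by (rule has_integral_of_bool_ge)
  then show ?thesis
    by (rule has_integral_eq[rotated]) (use le_locate_iff[OF x] False k in auto)
qed

lemma has_integral_locate_eq:
  assumes x: "x \<in> standard_simplex n" and k: "k \<le> n"
  shows "((\<lambda>t. of_bool (locate n x t = k)) has_integral x k) {0..1}"
proof -
  have "((\<lambda>t. of_bool (k \<le> locate n x t) - of_bool (Suc k \<le> locate n x t) :: real) has_integral
      (1 - partial_sum x k) - (1 - partial_sum x (Suc k))) {0..1}"
    using k by (intro has_integral_diff has_integral_locate_ge[OF x]) auto
  then have "((\<lambda>t. of_bool (k \<le> locate n x t) - of_bool (Suc k \<le> locate n x t) :: real) has_integral x k) {0..1}"
    by (simp add: partial_sum_Suc)
  then show ?thesis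
    by (rule has_integral_eq[rotated]) auto
qed

text \<open>The analogue of \<open>simplex_push\<close> with labels in \<open>P\<close> in place of
  an ordinal. It is a function on the whole type, so equality of weights is plain equality of
  functions.\<close>

definition weight :: "nat \<Rightarrow> (nat \<Rightarrow> 'a) \<Rightarrow> (nat \<Rightarrow> real) \<Rightarrow> 'a \<Rightarrow> real" where
  "weight n \<sigma> x p = (\<Sum>i | i \<le> n \<and> \<sigma> i = p. x i)"

lemma mass_cell_path:
  assumes P: "finite_poset P" and \<sigma>: "\<sigma> \<in> order_maps (ordinal n) P" and x: "x \<in> standard_simplex n"
    and p: "p \<in> Field P"
  shows "mass (cell_path n \<sigma> x) p = weight n \<sigma> x p"
proof -
  have "((\<lambda>t. \<Sum>i | i \<le> n \<and> \<sigma> i = p. of_bool (locate n x t = i)) has_integral weight n \<sigma> x p) {0..1}"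
    unfolding weight_def by (intro has_integral_sum has_integral_locate_eq[OF x]) auto
  then have "((\<lambda>t. of_bool (cell_path n \<sigma> x t = p)) has_integral weight n \<sigma> x p) {0..1}"
  proof (rule has_integral_eq[rotated])
    fix t :: real assume t: "t \<in> {0..1}"
    have "(\<Sum>i | i \<le> n \<and> \<sigma> i = p. of_bool (locate n x t = i)) =
        (of_bool (locate n x t \<in> {i. i \<le> n \<and> \<sigma> i = p}) :: real)"
      by (simp add: of_bool_def)
    then show "(\<Sum>i | i \<le> n \<and> \<sigma> i = p. of_bool (locate n x t = i)) =
        (of_bool (cell_path n \<sigma> x t = p) :: real)"
      using t locate_le[of t n x] by (simp add: cell_path_def)
  qed
  then show ?thesis
    using has_integral_mass[OF P cell_path_in_usc_maps[OF P \<sigma> x] p] has_integral_unique by blast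
qed

lemma has_integral_abs_diff_of_bool:
  assumes "0 \<le> a" "a \<le> 1" "0 \<le> b" "b \<le> 1"
  shows "((\<lambda>t::real. \<bar>of_bool (a \<le> t) - of_bool (b \<le> t)\<bar> :: real) has_integral \<bar>a - b\<bar>) {0..1}"
  using assms
proof (induction a b rule: linorder_wlog)
  case (le a b)
  have "((\<lambda>t::real. of_bool (a \<le> t) - of_bool (b \<le> t) :: real) has_integral (1 - a) - (1 - b)) {0..1}"
    using le by (intro has_integral_diff has_integral_of_bool_ge) auto
  then have "((\<lambda>t::real. \<bar>of_bool (a \<le> t) - of_bool (b \<le> t)\<bar> :: real) has_integral (1 - a) - (1 - b)) {0..1}"
    by (rule has_integral_eq[rotated]) (use le(1) in auto)
  also have "(1 - a) - (1 - b) = \<bar>a - b\<bar>"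
    using le(1) by simp
  finally show ?case .
next
  case (sym a b)
  then show ?case by (simp add: abs_minus_commute)
qed

text \<open>The two paths can only differ at times that separate the \<open>k\<close>-th division points of
  \<open>x\<close> and \<open>y\<close> for some \<open>k\<close>.\<close>

lemma usc_dist_cell_path_le:
  assumes P: "finite_poset P" and \<sigma>: "\<sigma> \<in> order_maps (ordinal n) P"
    and x: "x \<in> standard_simplex n" and y: "y \<in> standard_simplex n"
  shows "usc_dist (cell_path n \<sigma> x) (cell_path n \<sigma> y) \<le> (\<Sum>k\<le>n. \<bar>partial_sum x k - partial_sum y k\<bar>)"
proof (rule has_integral_le)
  show "((\<lambda>t. discrete_metric.dd (cell_path n \<sigma> x t) (cell_path n \<sigma> y t)) has_integral
      usc_dist (cell_path n \<sigma> x) (cell_path n \<sigma> y)) {0..1}"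
    unfolding usc_dist_def
    using usc_dist_integrable[OF P cell_path_in_usc_maps[OF P \<sigma> x] cell_path_in_usc_maps[OF P \<sigma> y]]
    by (rule integrable_integral)
  show "((\<lambda>t. \<Sum>k\<le>n. \<bar>of_bool (partial_sum x k \<le> t) - of_bool (partial_sum y k \<le> t)\<bar>) has_integral
      (\<Sum>k\<le>n. \<bar>partial_sum x k - partial_sum y k\<bar>)) {0..1}"
    using partial_sum_bounds[OF x] partial_sum_bounds[OF y]
    by (intro has_integral_sum has_integral_abs_diff_of_bool) auto
  fix t :: real assume t: "t \<in> {0..1}"
  let ?d = "\<lambda>k. \<bar>of_bool (partial_sum x k \<le> t) - of_bool (partial_sum y k \<le> t)\<bar> :: real"
  show "discrete_metric.dd (cell_path n \<sigma> x t) (cell_path n \<sigma> y t) \<le> (\<Sum>k\<le>n. ?d k)"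
  proof (cases "locate n x t = locate n y t")
    case True
    then show ?thesis
      using t by (simp add: cell_path_def discrete_metric.dd_def sum_nonneg)
  next
    case False
    \<comment> \<open>At time \<open>t\<close> exactly one of the two points has passed its
      \<open>k\<close>-th division point, namely the one with the larger index.\<close>
    define k where "k = max (locate n x t) (locate n y t)"
    have k: "k \<le> n"
      using locate_le t by (auto simp: k_def)
    have "?d k = 1"
      using le_locate_iff[OF x _ k, of t] le_locate_iff[OF y _ k, of t] t False
      by (auto simp: k_def max_def split: if_splits)
    moreover have "?d k \<le> (\<Sum>k\<le>n. ?d k)"
      using k by (intro member_le_sum) auto
    ultimately show ?thesis
      by (auto simp: discrete_metric.dd_def)
  qed
qed

section \<open>Gluing and weights\<close>

lemma weight_nonneg:
  assumes "x \<in> standard_simplex n"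
  shows "0 \<le> weight n \<sigma> x p"
  unfolding weight_def by (intro sum_nonneg standard_simplexD(1)[OF assms])

lemma weight_eq_0:
  assumes "p \<notin> \<sigma> ` {..n}"
  shows "weight n \<sigma> x p = 0"
proof -
  have "{i. i \<le> n \<and> \<sigma> i = p} = {}"
    using assms by auto
  then show ?thesis
    by (simp only: weight_def sum.empty)
qed

text \<open>The fibre of the composite over \<open>p\<close> is the disjoint union of the fibres of
  \<open>\<theta>\<close> over the indices \<open>i\<close> with \<open>\<tau> i = p\<close>. This
  is the invariance of weights under one gluing step.\<close>

lemma weight_simplex_push:
  assumes \<theta>: "\<theta> \<in> order_maps (ordinal n) (ordinal m)"
  shows "weight n (compose {..n} \<tau> \<theta>) x p = weight m \<tau> (simplex_push n \<theta> x) p"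
proof -
  have "\<theta> j \<le> m" if "j \<le> n" for j
    using order_maps_ordinalD(2)[OF \<theta> that] by simp
  then have "(\<Sum>i\<in>{i. i \<le> m \<and> \<tau> i = p}. \<Sum>j\<in>{j \<in> {j. j \<le> n \<and> \<tau> (\<theta> j) = p}. \<theta> j = i}. x j) =
      (\<Sum>j | j \<le> n \<and> \<tau> (\<theta> j) = p. x j)"
    by (intro sum.group) auto
  moreover have "{j \<in> {j. j \<le> n \<and> \<tau> (\<theta> j) = p}. \<theta> j = i} = {j \<in> {..n}. \<theta> j = i}" if "\<tau> i = p" for i
    using that by auto
  moreover have "{j. j \<le> n \<and> compose {..n} \<tau> \<theta> j = p} = {j. j \<le> n \<and> \<tau> (\<theta> j) = p}"
    by (auto simp: compose_def)
  ultimately show ?thesis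
    by (simp add: weight_def simplex_push_def)
qed

lemma simplex_push_in_standard_simplex:
  assumes \<theta>: "\<theta> \<in> order_maps (ordinal n) (ordinal m)" and x: "x \<in> standard_simplex n"
  shows "simplex_push n \<theta> x \<in> standard_simplex m"
proof -
  have \<theta>_le: "\<theta> j \<le> m" if "j \<le> n" for j
    using order_maps_ordinalD(2)[OF \<theta> that] by simp
  have "0 \<le> simplex_push n \<theta> x i" for i
    unfolding simplex_push_def by (intro sum_nonneg standard_simplexD(1)[OF x])
  moreover have "simplex_push n \<theta> x i \<le> 1" for i
  proof -
    have "simplex_push n \<theta> x i \<le> (\<Sum>j\<le>n. x j)"
      unfolding simplex_push_def by (rule sum_mono2) (auto intro: standard_simplexD(1)[OF x])
    then show ?thesis
      by (simp add: standard_simplexD(2)[OF x])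
  qed
  moreover have "simplex_push n \<theta> x i = 0" if "m < i" for i
  proof -
    have "{j \<in> {..n}. \<theta> j = i} = {}"
      using that \<theta>_le by fastforce
    then show ?thesis
      by (simp only: simplex_push_def sum.empty)
  qed
  moreover have "(\<Sum>i\<le>m. simplex_push n \<theta> x i) = (\<Sum>j\<le>n. x j)"
    unfolding simplex_push_def by (rule sum.group) (use \<theta>_le in auto)
  ultimately show ?thesis
    by (simp add: standard_simplex_def standard_simplexD(2)[OF x])
qed

section \<open>The coproduct over \<open>S(P)\<close> in terms of order maps\<close>

lemma simplices_simp_real [simp]: "simplices (simp_real P) n = order_maps (ordinal n) P"
  by (simp add: simp_real_def)

lemma act_simp_real [simp]: "act (simp_real P) m n \<theta> \<sigma> = compose {..m} \<sigma> \<theta>"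
  by (simp add: simp_real_def)

lemma order_maps_ordinal_id: "(\<lambda>i\<in>{..n}. i) \<in> order_maps (ordinal n) (ordinal n)"
  using order_maps_id[of "ordinal n"] by simp

lemma simp_real_map_id:
  assumes "\<sigma> \<in> order_maps (ordinal n) P"
  shows "simp_real_map (ordinal n) \<sigma> n (\<lambda>i\<in>{..n}. i) = \<sigma>"
  using order_maps_ordinal_id[of n] order_maps_ordinalD(1)[OF assms]
  by (auto simp: simp_real_map_def compose_def fun_eq_iff extensional_def)

text \<open>Naturality along \<open>\<eta>\<close>, applied to the identity of \<open>[n]\<close>,
  recovers \<open>\<alpha> m \<eta>\<close>. Outside the simplices both sides are
  \<open>undefined\<close>, so the equation holds between HOL functions.\<close>

lemma yoneda_simp_real:
  assumes "\<alpha> \<in> sset_maps (Delta n) (simp_real P)"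
  shows "\<alpha> n (\<lambda>i\<in>{..n}. i) \<in> order_maps (ordinal n) P"
    and "simp_real_map (ordinal n) (\<alpha> n (\<lambda>i\<in>{..n}. i)) = \<alpha>"
proof -
  have ext: "\<alpha> m \<in> order_maps (ordinal m) (ordinal n) \<rightarrow>\<^sub>E order_maps (ordinal m) P" for m
    using assms by (simp add: sset_maps_def)
  show "\<alpha> n (\<lambda>i\<in>{..n}. i) \<in> order_maps (ordinal n) P"
    using ext[of n] order_maps_ordinal_id by blast
  have "compose {..m} (\<alpha> n (\<lambda>i\<in>{..n}. i)) \<eta> = \<alpha> m \<eta>" if \<eta>: "\<eta> \<in> order_maps (ordinal m) (ordinal n)" for m \<eta>
  proof -
    have "compose {..m} (\<alpha> n (\<lambda>i\<in>{..n}. i)) \<eta> = \<alpha> m (compose {..m} (\<lambda>i\<in>{..n}. i) \<eta>)"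
      using assms \<eta> order_maps_ordinal_id[of n] by (simp add: sset_maps_def)
    also have "compose {..m} (\<lambda>i\<in>{..n}. i) \<eta> = \<eta>"
      using order_maps_ordinalD(1,2)[OF \<eta>] by (auto simp: compose_def fun_eq_iff extensional_def)
    finally show ?thesis .
  qed
  moreover have "\<alpha> m \<eta> = undefined" if "\<eta> \<notin> order_maps (ordinal m) (ordinal n)" for m \<eta>
    using ext[of m] that by (rule PiE_arb)
  ultimately show "simp_real_map (ordinal n) (\<alpha> n (\<lambda>i\<in>{..n}. i)) = \<alpha>"
    by (auto simp: simp_real_map_def fun_eq_iff)
qed

text \<open>Functoriality of \<open>S\<close>. It serves twice: to rewrite the triangles that define
  gluing, and to compute \<open>geom_real_map\<close> on cells.\<close>

lemma sset_comp_simp_real_map: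
  fixes P :: "'a rel"
  assumes "h \<in> order_maps P Q"
  shows "sset_comp (simp_real P) (simp_real_map Q k) (simp_real_map P h) =
    simp_real_map P (compose (Field P) k h)"
proof (rule ext, rule ext)
  fix n and \<sigma> :: "nat \<Rightarrow> 'a"
  show "sset_comp (simp_real P) (simp_real_map Q k) (simp_real_map P h) n \<sigma> =
      simp_real_map P (compose (Field P) k h) n \<sigma>"
  proof (cases "\<sigma> \<in> order_maps (ordinal n) P")
    case True
    then have "compose {..n} h \<sigma> \<in> order_maps (ordinal n) Q"
      using order_maps_compose[OF True assms] by simp
    moreover have "compose {..n} k (compose {..n} h \<sigma>) = compose {..n} (compose (Field P) k h) \<sigma>"
      using order_maps_ordinalD(2)[OF True] by (auto simp: compose_def fun_eq_iff)
    ultimately show ?thesis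
      using True by (simp add: sset_comp_def simp_real_map_def compose_def)
  qed (simp add: sset_comp_def simp_real_map_def compose_def)
qed

text \<open>By the Yoneda lemma every point of the coproduct over \<open>S(P)\<close> has this form.\<close>

abbreviation cell ::
  "nat \<Rightarrow> (nat \<Rightarrow> 'a) \<Rightarrow> (nat \<Rightarrow> real) \<Rightarrow> (nat \<times> (nat \<Rightarrow> (nat \<Rightarrow> nat) \<Rightarrow> (nat \<Rightarrow> 'a))) \<times> (nat \<Rightarrow> real)" where
  "cell n \<sigma> x \<equiv> ((n, simp_real_map (ordinal n) \<sigma>), x)"

lemma over_objects_simp_real:
  "over_objects (simp_real P) = {(n, simp_real_map (ordinal n) \<sigma>) | n \<sigma>. \<sigma> \<in> order_maps (ordinal n) P}"
proof -
  have "\<alpha> \<in> sset_maps (Delta n) (simp_real P) \<longleftrightarrow>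
      (\<exists>\<sigma>. \<alpha> = simp_real_map (ordinal n) \<sigma> \<and> \<sigma> \<in> order_maps (ordinal n) P)" for n \<alpha>
    using yoneda_simp_real[of \<alpha> n P] simp_real_map_in_sset_maps[of _ "ordinal n" P] by metis
  then show ?thesis
    by (auto simp: over_objects_def)
qed

lemma topspace_top_simplex: "topspace (top_simplex n) = standard_simplex n"
  by (auto simp: top_simplex_def topspace_Euclidean_space standard_simplex_def)

lemma topspace_over_coproduct:
  "topspace (over_coproduct (simp_real P)) =
    {cell n \<sigma> x | n \<sigma> x. \<sigma> \<in> order_maps (ordinal n) P \<and> x \<in> standard_simplex n}"
  by (auto simp: over_coproduct_def over_objects_simp_real topspace_top_simplex)

lemma over_glue_simp_real_iff:
  "over_glue (simp_real P) a b \<longleftrightarrow>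
    (\<exists>n m \<theta> \<tau> x. \<theta> \<in> order_maps (ordinal n) (ordinal m) \<and> \<tau> \<in> order_maps (ordinal m) P \<and>
       x \<in> standard_simplex n \<and> a = cell n (compose {..n} \<tau> \<theta>) x \<and> b = cell m \<tau> (simplex_push n \<theta> x))"
  (is "?L \<longleftrightarrow> ?R")
proof
  assume ?L
  then show ?R
  proof cases
    case (1 n \<alpha> m \<beta> \<theta> x)
    obtain \<tau> where \<tau>: "\<tau> \<in> order_maps (ordinal m) P" "\<beta> = simp_real_map (ordinal m) \<tau>"
      using 1 by (auto simp: over_objects_simp_real)
    have "\<alpha> = simp_real_map (ordinal n) (compose {..n} \<tau> \<theta>)"
      using 1 by (simp add: \<tau>(2) sset_comp_simp_real_map)
    then show ?thesis
      using 1 \<tau> by blast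
  qed
next
  assume ?R
  then obtain n m \<theta> \<tau> x where *: "\<theta> \<in> order_maps (ordinal n) (ordinal m)" "\<tau> \<in> order_maps (ordinal m) P"
    "x \<in> standard_simplex n" "a = cell n (compose {..n} \<tau> \<theta>) x" "b = cell m \<tau> (simplex_push n \<theta> x)"
    by blast
  have "compose {..n} \<tau> \<theta> \<in> order_maps (ordinal n) P"
    using order_maps_compose[OF *(1,2)] by simp
  then show ?L
    unfolding *(4,5) using *
    by (intro over_glue.intros) (auto simp: over_objects_simp_real sset_comp_simp_real_map)
qed

text \<open>Evaluation at the identity is the Yoneda inverse: it recovers the order map
  \<open>\<sigma>\<close> from the simplex without choosing a representation.\<close>

definition realize ::
  "(nat \<times> (nat \<Rightarrow> (nat \<Rightarrow> nat) \<Rightarrow> (nat \<Rightarrow> 'a))) \<times> (nat \<Rightarrow> real) \<Rightarrow> real \<Rightarrow> 'a" where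
  "realize = (\<lambda>((n, \<alpha>), x). cell_path n (\<alpha> n (\<lambda>i\<in>{..n}. i)) x)"

lemma realize_cell:
  assumes "\<sigma> \<in> order_maps (ordinal n) P"
  shows "realize (cell n \<sigma> x) = cell_path n \<sigma> x"
  by (simp add: realize_def simp_real_map_id[OF assms])

lemma realize_in_usc_maps:
  assumes "finite_poset P" "a \<in> topspace (over_coproduct (simp_real P))"
  shows "realize a \<in> usc_maps P"
  using assms by (auto simp: topspace_over_coproduct realize_cell cell_path_in_usc_maps)

text \<open>On \<open>Field P\<close> weights are the masses of the paths, and masses decide
  distance 0. Elsewhere, where \<open>mass_cell_path\<close> says nothing, both weights
  vanish.\<close>

lemma realize_equiv_iff:
  assumes P: "finite_poset P" and \<sigma>: "\<sigma> \<in> order_maps (ordinal n) P" and x: "x \<in> standard_simplex n"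
    and \<tau>: "\<tau> \<in> order_maps (ordinal m) P" and y: "y \<in> standard_simplex m"
  shows "(realize (cell n \<sigma> x), realize (cell m \<tau> y)) \<in> usc_equiv P \<longleftrightarrow> weight n \<sigma> x = weight m \<tau> y"
proof
  assume L: "(realize (cell n \<sigma> x), realize (cell m \<tau> y)) \<in> usc_equiv P"
  show "weight n \<sigma> x = weight m \<tau> y"
  proof
    fix p
    show "weight n \<sigma> x p = weight m \<tau> y p"
    proof (cases "p \<in> Field P")
      case True
      then show ?thesis
        using L mass_cong[OF P _ _ True, of "cell_path n \<sigma> x" "cell_path m \<tau> y"]
          mass_cell_path[OF P \<sigma> x True] mass_cell_path[OF P \<tau> y True]
        by (auto simp: usc_equiv_def realize_cell[OF \<sigma>] realize_cell[OF \<tau>])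
    next
      case False
      then have "p \<notin> \<sigma> ` {..n}" "p \<notin> \<tau> ` {..m}"
        using order_maps_ordinalD(2)[OF \<sigma>] order_maps_ordinalD(2)[OF \<tau>] by auto
      then show ?thesis
        by (simp add: weight_eq_0)
    qed
  qed
next
  assume "weight n \<sigma> x = weight m \<tau> y"
  then have "usc_dist (cell_path n \<sigma> x) (cell_path m \<tau> y) = 0"
    using P \<sigma> x \<tau> y
    by (intro usc_dist_eq_0_if_mass_eq[OF P] cell_path_in_usc_maps) (auto simp: mass_cell_path)
  then show "(realize (cell n \<sigma> x), realize (cell m \<tau> y)) \<in> usc_equiv P"
    using P \<sigma> x \<tau> y by (simp add: usc_equiv_def realize_cell[OF \<sigma>] realize_cell[OF \<tau>] cell_path_in_usc_maps)
qed

section \<open>Normal forms of points by their weights\<close>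

text \<open>The number of members of \<open>D\<close> strictly below an element is strictly
  increasing along the chain and less than \<open>card D\<close>. Hence it is a bijection onto
  \<open>{..<card D}\<close>, and \<open>e\<close> is its inverse. The equation for
  \<open>card D\<close> is recorded for the dimension bound in the compactness proof.\<close>

lemma enumerate_finite_chain:
  assumes P: "finite_poset P" and D: "D \<subseteq> Field P" "D \<noteq> {}"
    and chain: "\<And>p q. p \<in> D \<Longrightarrow> q \<in> D \<Longrightarrow> (p, q) \<in> P \<or> (q, p) \<in> P"
  obtains k e where "card D = Suc k" "e \<in> order_maps (ordinal k) P" "bij_betw e {..k} D"
proof -
  have fin: "finite D"
    using D(1) finite_posetD(1)[OF P] finite_subset by blast
  define below where "below p = {q \<in> D. (q, p) \<in> P \<and> q \<noteq> p}" for p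
  define rank where "rank p = card (below p)" for p
  have rank_less: "rank p < rank q" if "p \<in> D" "q \<in> D" "(p, q) \<in> P" "p \<noteq> q" for p q
  proof -
    have "below p \<subseteq> below q"
      using that finite_posetD(3,4)[OF P] by (auto simp: below_def dest: transD antisymD)
    moreover have "p \<in> below q" "p \<notin> below p"
      using that by (auto simp: below_def)
    ultimately have "below p \<subset> below q" by auto
    then show ?thesis
      unfolding rank_def by (rule psubset_card_mono[rotated]) (use fin in \<open>auto simp: below_def\<close>)
  qed
  have inj: "inj_on rank D"
    using chain rank_less by (metis inj_onI less_irrefl)
  have "rank p < card D" if "p \<in> D" for p
    unfolding rank_def using that by (intro psubset_card_mono[OF fin]) (auto simp: below_def)
  then have "rank ` D \<subseteq> {..<card D}" by auto
  then have "rank ` D = {..<card D}"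
    using card_image[OF inj] by (intro card_subset_eq) auto
  then have bij: "bij_betw rank D {..<card D}"
    using inj by (simp add: bij_betw_def)
  obtain k where k: "card D = Suc k"
    using fin D(2) by (metis card_eq_0_iff not0_implies_Suc)
  define e where "e = (\<lambda>i\<in>{..k}. inv_into D rank i)"
  have "bij_betw (inv_into D rank) {..k} D"
    using bij_betw_inv_into[OF bij] by (simp add: k lessThan_Suc_atMost)
  then have e: "bij_betw e {..k} D"
    by (rule bij_betw_cong[THEN iffD1, rotated]) (simp add: e_def)
  have rank_e: "rank (e i) = i" if "i \<le> k" for i
    using that bij_betw_inv_into_right[OF bij, of i] by (simp add: e_def k)
  have e_in: "e i \<in> D" if "i \<le> k" for i
    using that bij_betwE[OF e] by simp
  have "e \<in> order_maps (ordinal k) P"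
  proof (rule order_maps_ordinalI)
    show "e \<in> extensional {..k}"
      by (simp add: e_def)
    fix i j assume ij: "i \<le> j" "j \<le> k"
    show "(e i, e j) \<in> P"
    proof (rule ccontr)
      assume "(e i, e j) \<notin> P"
      then have "(e j, e i) \<in> P" "e j \<noteq> e i"
        using chain[of "e i" "e j"] chain[of "e i" "e i"] e_in ij by auto
      then show False
        using rank_less[of "e j" "e i"] rank_e e_in ij by auto
    qed
  qed
  then show thesis
    using that k e by blast
qed

text \<open>A section of \<open>weight\<close> along an injective simplex \<open>e\<close>. The
  value 0 above \<open>k\<close> is what membership in \<open>standard_simplex k\<close>
  requires.\<close>

definition chain_point :: "nat \<Rightarrow> (nat \<Rightarrow> 'a) \<Rightarrow> ('a \<Rightarrow> real) \<Rightarrow> nat \<Rightarrow> real" where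
  "chain_point k e w = (\<lambda>i. if i \<le> k then w (e i) else 0)"

lemma chain_point_in_standard_simplex:
  assumes e: "bij_betw e {..k} D" and "\<And>p. 0 \<le> w p" "sum w D = 1"
  shows "chain_point k e w \<in> standard_simplex k"
proof -
  have sum: "(\<Sum>i\<le>k. w (e i)) = 1"
    using sum.reindex_bij_betw[OF e, of w] assms(3) by simp
  have "w (e i) \<le> (\<Sum>i\<le>k. w (e i))" if "i \<le> k" for i
    using that assms(2) by (intro member_le_sum) auto
  then have "w (e i) \<le> 1" if "i \<le> k" for i
    using that sum by simp
  then show ?thesis
    using assms(2) sum by (simp add: standard_simplex_def chain_point_def)
qed

lemma weight_chain_point:
  assumes e: "bij_betw e {..k} D" and w: "\<And>p. p \<notin> D \<Longrightarrow> w p = 0"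
  shows "weight k e (chain_point k e w) = w"
proof
  fix p
  show "weight k e (chain_point k e w) p = w p"
  proof (cases "p \<in> D")
    case True
    then obtain i where i: "i \<le> k" "p = e i"
      using bij_betw_imp_surj_on[OF e] by auto
    then have "{j. j \<le> k \<and> e j = p} = {i}"
      using bij_betw_imp_inj_on[OF e] by (auto dest: inj_onD)
    then show ?thesis
      using i by (simp add: weight_def chain_point_def)
  next
    case False
    then show ?thesis
      using w weight_eq_0[of p e k] bij_betw_imp_surj_on[OF e] by simp
  qed
qed

text \<open>Sending \<open>i\<close> to the position of \<open>\<sigma> i\<close> in the enumeration
  factors \<open>\<sigma>\<close> through \<open>e\<close>, and pushing \<open>x\<close> along this
  map collects the weights. \<open>D\<close> may exceed the image of \<open>\<sigma>\<close>, so
  that a simplex can also be pushed into one of which it is a proper face.\<close>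

lemma over_glue_chain_point:
  assumes P: "finite_poset P" and \<sigma>: "\<sigma> \<in> order_maps (ordinal n) P" and x: "x \<in> standard_simplex n"
    and e: "e \<in> order_maps (ordinal k) P" "bij_betw e {..k} D" and D: "\<sigma> ` {..n} \<subseteq> D"
  shows "over_glue (simp_real P) (cell n \<sigma> x) (cell k e (chain_point k e (weight n \<sigma> x)))"
proof -
  define \<theta> where "\<theta> = (\<lambda>i\<in>{..n}. inv_into {..k} e (\<sigma> i))"
  have \<theta>: "\<theta> i \<le> k" "e (\<theta> i) = \<sigma> i" if "i \<le> n" for i
  proof -
    have "\<sigma> i \<in> e ` {..k}"
      using that D bij_betw_imp_surj_on[OF e(2)] by auto
    then show "\<theta> i \<le> k" "e (\<theta> i) = \<sigma> i"
      using that inv_into_into[of "\<sigma> i" e "{..k}"] f_inv_into_f[of "\<sigma> i" e "{..k}"]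
      by (auto simp: \<theta>_def)
  qed
  note inj = inj_onD[OF bij_betw_imp_inj_on[OF e(2)]]
  have "\<theta> \<in> order_maps (ordinal n) (ordinal k)"
  proof (rule order_maps_ordinalI)
    show "\<theta> \<in> extensional {..n}"
      by (simp add: \<theta>_def)
    fix i j assume ij: "i \<le> j" "j \<le> n"
    have "\<theta> i \<le> \<theta> j"
    proof (rule ccontr)
      assume "\<not> \<theta> i \<le> \<theta> j"
      then have "(\<sigma> j, \<sigma> i) \<in> P"
        using order_maps_ordinalD(3)[OF e(1), of "\<theta> j" "\<theta> i"] \<theta> ij by simp
      moreover have "(\<sigma> i, \<sigma> j) \<in> P"
        using order_maps_ordinalD(3)[OF \<sigma>] ij by simp
      ultimately have "\<sigma> i = \<sigma> j"
        using finite_posetD(4)[OF P] by (auto dest: antisymD)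
      then show False
        using \<open>\<not> \<theta> i \<le> \<theta> j\<close> ij by (simp add: \<theta>_def)
    qed
    then show "(\<theta> i, \<theta> j) \<in> ordinal k"
      using \<theta> ij by (simp add: ordinal_def)
  qed
  moreover have "compose {..n} e \<theta> = \<sigma>"
    using \<theta>(2) order_maps_ordinalD(1)[OF \<sigma>] by (auto simp: compose_def fun_eq_iff extensional_def)
  moreover have "simplex_push n \<theta> x = chain_point k e (weight n \<sigma> x)"
  proof
    fix i
    show "simplex_push n \<theta> x i = chain_point k e (weight n \<sigma> x) i"
    proof (cases "i \<le> k")
      case True
      then have "{j \<in> {..n}. \<theta> j = i} = {j. j \<le> n \<and> \<sigma> j = e i}"
        using \<theta> inj[of "\<theta> j" i for j] by auto
      then show ?thesis
        using True by (simp add: simplex_push_def chain_point_def weight_def)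
    next
      case False
      then have "{j \<in> {..n}. \<theta> j = i} = {}"
        using \<theta>(1) by auto
      then show ?thesis
        using False by (simp only: simplex_push_def chain_point_def sum.empty if_False)
    qed
  qed
  ultimately show ?thesis
    unfolding over_glue_simp_real_iff using e(1) x by metis
qed

lemma order_maps_chain:
  assumes "\<sigma> \<in> order_maps (ordinal n) P" "p \<in> \<sigma> ` {..n}" "q \<in> \<sigma> ` {..n}"
  shows "(p, q) \<in> P \<or> (q, p) \<in> P"
proof -
  obtain i j where ij: "i \<le> n" "j \<le> n" "p = \<sigma> i" "q = \<sigma> j"
    using assms(2,3) by auto
  then show ?thesis
    using order_maps_ordinalD(3)[OF assms(1), of i j] order_maps_ordinalD(3)[OF assms(1), of j i]
    by (cases "i \<le> j") auto
qed

lemma sum_weight: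
  assumes "x \<in> standard_simplex n"
  shows "(\<Sum>p\<in>\<sigma> ` {..n}. weight n \<sigma> x p) = 1"
proof -
  have "(\<Sum>p\<in>\<sigma> ` {..n}. \<Sum>i\<in>{i\<in>{..n}. \<sigma> i = p}. x i) = (\<Sum>i\<le>n. x i)"
    by (rule sum.group) auto
  then show ?thesis
    by (simp add: weight_def standard_simplexD(2)[OF assms])
qed

lemma weight_pos_iff:
  assumes "x \<in> standard_simplex n"
  shows "0 < weight n \<sigma> x p \<longleftrightarrow> weight n \<sigma> x p \<noteq> 0"
  using weight_nonneg[OF assms, of \<sigma> p] by linarith

text \<open>A point of \<open>|S(P)|\<close> is determined by its weights: it is represented in the nondegenerate
  simplex on their support.\<close>

lemma equivclp_over_glue_normal_form:
  assumes P: "finite_poset P" and \<sigma>: "\<sigma> \<in> order_maps (ordinal n) P" and x: "x \<in> standard_simplex n"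
    and e: "e \<in> order_maps (ordinal k) P" "bij_betw e {..k} {p. 0 < weight n \<sigma> x p}"
  shows "equivclp (over_glue (simp_real P)) (cell n \<sigma> x) (cell k e (chain_point k e (weight n \<sigma> x)))"
proof -
  let ?w = "weight n \<sigma> x" and ?D = "\<sigma> ` {..n}" and ?C = "{p. 0 < weight n \<sigma> x p}"
  have CD: "?C \<subseteq> ?D"
    using weight_eq_0[of _ \<sigma> n x] by force
  have zero: "?w p = 0" if "p \<notin> ?C" for p
    using that weight_pos_iff[OF x, of \<sigma> p] by simp
  have "sum ?w ?C = sum ?w ?D"
    by (intro sum.mono_neutral_left CD ballI zero) auto
  then have y: "chain_point k e ?w \<in> standard_simplex k"
    using weight_nonneg[OF x] sum_weight[OF x]
    by (intro chain_point_in_standard_simplex[OF e(2)]) auto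
  have "?D \<subseteq> Field P"
    using order_maps_ordinalD(2)[OF \<sigma>] by auto
  then obtain m d where d: "d \<in> order_maps (ordinal m) P" "bij_betw d {..m} ?D"
    using enumerate_finite_chain[OF P _ _ order_maps_chain[OF \<sigma>]] by blast
  have "over_glue (simp_real P) (cell n \<sigma> x) (cell m d (chain_point m d ?w))"
    using over_glue_chain_point[OF P \<sigma> x d] by simp
  \<comment> \<open>The support lies in the image of \<open>\<sigma>\<close>, and the normal form
    has the same weights, so it is pushed to the same point as \<open>cell n \<sigma> x\<close>. The
    link is a zigzag with both arrows ending in the simplex on the image.\<close>
  moreover have "over_glue (simp_real P) (cell k e (chain_point k e ?w)) (cell m d (chain_point m d ?w))"
    using over_glue_chain_point[OF P e(1) y d] bij_betw_imp_surj_on[OF e(2)] CD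
      weight_chain_point[OF e(2), of ?w, OF zero] by simp
  ultimately show ?thesis
    by (meson equivclp_trans r_into_equivclp converse_r_into_equivclp)
qed

lemma weight_support_enumerate:
  assumes P: "finite_poset P" and \<sigma>: "\<sigma> \<in> order_maps (ordinal n) P" and x: "x \<in> standard_simplex n"
  obtains k e where "e \<in> order_maps (ordinal k) P" "bij_betw e {..k} {p. 0 < weight n \<sigma> x p}"
proof -
  let ?C = "{p. 0 < weight n \<sigma> x p}"
  have sub: "?C \<subseteq> \<sigma> ` {..n}"
    using weight_eq_0[of _ \<sigma> n x] by force
  then have field: "?C \<subseteq> Field P"
    using order_maps_ordinalD(2)[OF \<sigma>] by auto
  have ne: "?C \<noteq> {}"
  proof
    assume "?C = {}"
    then have "weight n \<sigma> x p = 0" for p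
      using weight_pos_iff[OF x, of \<sigma> p] by blast
    then show False
      using sum_weight[OF x, of \<sigma>] by simp
  qed
  have chain: "(p, q) \<in> P \<or> (q, p) \<in> P" if "p \<in> ?C" "q \<in> ?C" for p q
    using order_maps_chain[OF \<sigma> subsetD[OF sub] subsetD[OF sub]] that .
  show thesis
    by (rule enumerate_finite_chain[OF P field ne chain]) (simp, simp, rule that)
qed

lemma over_glue_realize:
  assumes P: "finite_poset P" and "over_glue (simp_real P) a b"
  shows "a \<in> topspace (over_coproduct (simp_real P))" "b \<in> topspace (over_coproduct (simp_real P))"
    and "(realize a, realize b) \<in> usc_equiv P"
proof -
  obtain n m \<theta> \<tau> x where *: "\<theta> \<in> order_maps (ordinal n) (ordinal m)" "\<tau> \<in> order_maps (ordinal m) P"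
    "x \<in> standard_simplex n" "a = cell n (compose {..n} \<tau> \<theta>) x" "b = cell m \<tau> (simplex_push n \<theta> x)"
    using assms(2) unfolding over_glue_simp_real_iff by blast
  have \<sigma>: "compose {..n} \<tau> \<theta> \<in> order_maps (ordinal n) P"
    using order_maps_compose[OF *(1,2)] by simp
  note y = simplex_push_in_standard_simplex[OF *(1,3)]
  show "a \<in> topspace (over_coproduct (simp_real P))" "b \<in> topspace (over_coproduct (simp_real P))"
    using * \<sigma> y unfolding topspace_over_coproduct by blast+
  show "(realize a, realize b) \<in> usc_equiv P"
    unfolding *(4,5) realize_equiv_iff[OF P \<sigma> *(3) *(2) y]
    by (rule ext) (rule weight_simplex_push[OF *(1)])
qed

text \<open>From left to right this makes the induced map well defined; from right to left it makes
  it injective. The converse holds because the support and its enumeration depend on the weights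
  alone, so both points share one normal form.\<close>

lemma over_equiv_iff_realize:
  assumes P: "finite_poset P"
    and a: "a \<in> topspace (over_coproduct (simp_real P))" and b: "b \<in> topspace (over_coproduct (simp_real P))"
  shows "(a, b) \<in> over_equiv (simp_real P) \<longleftrightarrow> (realize a, realize b) \<in> usc_equiv P"
proof
  note eq = equivE[OF equiv_usc_equiv[OF P]]
  assume "(a, b) \<in> over_equiv (simp_real P)"
  then have "equivclp (over_glue (simp_real P)) a b"
    by (simp add: over_equiv_def)
  then show "(realize a, realize b) \<in> usc_equiv P"
  proof (induction rule: equivclp_induct)
    case base
    show ?case
      using realize_in_usc_maps[OF P a] by (simp add: usc_equiv_def)
  next
    case (step y z)
    then have "(realize y, realize z) \<in> usc_equiv P"
      using over_glue_realize(3)[OF P] eq by (metis symD)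
    with step.IH show ?case
      using eq by (metis transD)
  qed
next
  assume L: "(realize a, realize b) \<in> usc_equiv P"
  obtain n \<sigma> x m \<tau> y where a': "\<sigma> \<in> order_maps (ordinal n) P" "x \<in> standard_simplex n" "a = cell n \<sigma> x"
    and b': "\<tau> \<in> order_maps (ordinal m) P" "y \<in> standard_simplex m" "b = cell m \<tau> y"
    using a b unfolding topspace_over_coproduct by blast
  have w: "weight n \<sigma> x = weight m \<tau> y"
    using L realize_equiv_iff[OF P a'(1,2) b'(1,2)] by (simp add: a'(3) b'(3))
  obtain k e where e: "e \<in> order_maps (ordinal k) P" "bij_betw e {..k} {p. 0 < weight n \<sigma> x p}"
    using weight_support_enumerate[OF P a'(1,2)] .
  have "equivclp (over_glue (simp_real P)) a b"
    using equivclp_over_glue_normal_form[OF P a'(1,2) e]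
      equivclp_over_glue_normal_form[OF P b'(1,2) e(1)] e(2)
    unfolding a'(3) b'(3) w by (meson equivclp_trans equivclp_sym)
  then show "(a, b) \<in> over_equiv (simp_real P)"
    using a b by (simp add: over_equiv_def)
qed

section \<open>Functoriality and surjectivity\<close>

text \<open>The condition on \<open>f\<close> concerns only values of \<open>f\<close>. So the
  superlevel set of \<open>p\<close> is split over the finitely many values \<open>q\<close> of
  \<open>f\<close> with \<open>h q\<close> above \<open>p\<close>, each contributing a superlevel
  set of \<open>f\<close> itself.\<close>

lemma compose_in_usc_maps:
  assumes P: "finite_poset P" and Q: "finite_poset Q" and h: "h \<in> order_maps P Q" and f: "f \<in> usc_maps P"
  shows "compose {0..1} h f \<in> usc_maps Q"
proof -
  have order: "f \<in> order_maps unit_interval P"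
    using f by (simp add: usc_maps_def)
  have "f ` {0..1} \<subseteq> Field P"
    using usc_maps_in_Field[OF f] by auto
  then have fin: "finite (f ` {0..1})"
    using finite_posetD(1)[OF P] finite_subset by blast
  have "closed {t \<in> {0..1}. (p, compose {0..1} h f t) \<in> Q}" for p
  proof -
    have "{t \<in> {0..1}. (p, compose {0..1} h f t) \<in> Q} =
        (\<Union>q\<in>{q \<in> f ` {0..1}. (p, h q) \<in> Q}. {t \<in> {0..1}. (q, f t) \<in> P})" (is "?L = ?R")
    proof
      show "?L \<subseteq> ?R"
      proof
        fix t assume t: "t \<in> ?L"
        then have "(p, h (f t)) \<in> Q" "t \<in> {0..1}" "(f t, f t) \<in> P"
          using usc_maps_mono[OF f, of t t] by (auto simp: compose_def split: if_splits)
        then show "t \<in> ?R" by blast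
      qed
      show "?R \<subseteq> ?L"
      proof clarsimp
        fix s t :: real
        assume *: "(p, h (f s)) \<in> Q" "0 \<le> t" "t \<le> 1" "(f s, f t) \<in> P"
        then have "(h (f s), h (f t)) \<in> Q"
          using h by (simp add: order_maps_def)
        then show "(p, compose {0..1} h f t) \<in> Q"
          using * finite_posetD(3)[OF Q] by (auto simp: compose_def dest: transD)
      qed
    qed
    moreover have "closed ?R"
      using f fin by (intro closed_UN) (auto simp: usc_maps_def simp del: atLeastAtMost_iff)
    ultimately show ?thesis by simp
  qed
  then show ?thesis
    using order_maps_compose[OF order h] unfolding usc_maps_def by simp
qed

text \<open>Applying \<open>h\<close> can merge values but never separate them, so
  \<open>|h|\<close> does not increase distances.\<close>

lemma usc_equiv_compose:
  assumes P: "finite_poset P" and Q: "finite_poset Q" and h: "h \<in> order_maps P Q"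
    and fg: "(f, g) \<in> usc_equiv P"
  shows "(compose {0..1} h f, compose {0..1} h g) \<in> usc_equiv Q"
proof -
  have f: "f \<in> usc_maps P" and g: "g \<in> usc_maps P" and 0: "usc_dist f g = 0"
    using fg by (auto simp: usc_equiv_def)
  note hf = compose_in_usc_maps[OF P Q h f] and hg = compose_in_usc_maps[OF P Q h g]
  have "usc_dist (compose {0..1} h f) (compose {0..1} h g) \<le> usc_dist f g"
    unfolding usc_dist_def
    by (intro integral_le usc_dist_integrable[OF Q hf hg] usc_dist_integrable[OF P f g])
       (simp add: discrete_metric.dd_def compose_def)
  then have "usc_dist (compose {0..1} h f) (compose {0..1} h g) = 0"
    using 0 usc_dist_nonneg[of "compose {0..1} h f" "compose {0..1} h g"] by simp
  then show ?thesis
    using hf hg by (simp add: usc_equiv_def)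
qed

lemma realize_surj:
  assumes P: "finite_poset P" and f: "f \<in> usc_maps P"
  obtains a where "a \<in> topspace (over_coproduct (simp_real P))" "(f, realize a) \<in> usc_equiv P"
proof -
  \<comment> \<open>These masses are to become the weights of the point sought. They are cut off
    outside \<open>Field P\<close> because weights vanish there.\<close>
  define w where "w p = (if p \<in> Field P then mass f p else 0)" for p
  define C where "C = {p \<in> Field P. 0 < mass f p}"
  have w_nonneg: "0 \<le> w p" for p
    using mass_nonneg[OF P f] by (simp add: w_def)
  have w_zero: "w p = 0" if "p \<notin> C" for p
    using that mass_nonneg[OF P f, of p] by (auto simp: w_def C_def)
  have "sum w C = sum w (Field P)"
    using finite_posetD(1)[OF P] by (intro sum.mono_neutral_left ballI w_zero) (auto simp: C_def)
  also have "\<dots> = 1"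
    using sum_mass[OF P f] by (simp add: w_def)
  finally have sum_C: "sum w C = 1" .
  then have C: "C \<subseteq> Field P" "C \<noteq> {}"
    by (auto simp del: Collect_empty_eq simp: C_def)
  have chain: "(p, q) \<in> P \<or> (q, p) \<in> P" if "p \<in> C" "q \<in> C" for p q
  proof -
    have "p \<in> f ` {0..1}" "q \<in> f ` {0..1}"
      using that mass_eq_0[OF P f] by (force simp: C_def)+
    then obtain s t where "s \<in> {0..1}" "p = f s" "t \<in> {0..1}" "q = f t" by auto
    then show ?thesis
      using usc_maps_mono[OF f, of s t] usc_maps_mono[OF f, of t s] by (cases "s \<le> t") auto
  qed
  obtain k e where e: "e \<in> order_maps (ordinal k) P" "bij_betw e {..k} C"
    by (rule enumerate_finite_chain[OF P C chain])
  define y where "y = chain_point k e w"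
  have y: "y \<in> standard_simplex k"
    unfolding y_def using chain_point_in_standard_simplex[OF e(2) w_nonneg sum_C] .
  have weight: "weight k e y = w"
    unfolding y_def using weight_chain_point[OF e(2) w_zero] .
  have "mass f p = mass (cell_path k e y) p" if "p \<in> Field P" for p
    unfolding mass_cell_path[OF P e(1) y that] weight using that by (simp add: w_def)
  then have "usc_dist f (cell_path k e y) = 0"
    by (rule usc_dist_eq_0_if_mass_eq[OF P f cell_path_in_usc_maps[OF P e(1) y]])
  then have "(f, realize (cell k e y)) \<in> usc_equiv P"
    using f cell_path_in_usc_maps[OF P e(1) y] by (simp add: usc_equiv_def realize_cell[OF e(1)])
  moreover have "cell k e y \<in> topspace (over_coproduct (simp_real P))"
    using e(1) y by (auto simp: topspace_over_coproduct)
  ultimately show thesis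
    using that by blast
qed

section \<open>Topology of the realizations\<close>

lemma continuous_map_sum_topology:
  assumes "\<And>i. i \<in> I \<Longrightarrow> continuous_map (X i) Y (\<lambda>x. f (i, x))"
  shows "continuous_map (sum_topology X I) Y f"
proof -
  have "{x. (i, x) \<in> {a \<in> Sigma I (topspace \<circ> X). f a \<in> U}} = {x \<in> topspace (X i). f (i, x) \<in> U}"
    if "i \<in> I" for i U
    using that by auto
  then show ?thesis
    using assms by (fastforce simp: continuous_map_def openin_sum_topology Pi_iff)
qed

lemma continuous_map_top_simplex_coordinate: "continuous_map (top_simplex n) euclideanreal (\<lambda>x. x i)"
  unfolding top_simplex_def Euclidean_space_def
  by (intro continuous_map_from_subtopology continuous_map_product_projection) simp

lemma compactin_top_simplex: "compactin (top_simplex n) (standard_simplex n)"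
proof -
  have "standard_simplex n \<subseteq> {x. \<forall>i\<ge>Suc n. x i = 0}"
    by (auto simp: standard_simplex_def)
  then show ?thesis
    by (simp add: top_simplex_def Euclidean_space_def compactin_subtopology compactin_standard_simplex)
qed

lemma topspace_poset_real:
  assumes "finite_poset P"
  shows "topspace (poset_real P) = usc_maps P // usc_equiv P"
  unfolding poset_real_def Metric_space.topspace_mtopology[OF Metric_space_poset_real[OF assms]]
  by (rule poset_points_def)

text \<open>The bound in \<open>usc_dist_cell_path_le\<close> is a continuous function of
  \<open>y\<close> that vanishes at \<open>x\<close>; its sublevel set is the required
  neighbourhood.\<close>

lemma continuous_map_cell_path:
  assumes P: "finite_poset P" and \<sigma>: "\<sigma> \<in> order_maps (ordinal n) P"
  shows "continuous_map (top_simplex n) (poset_real P) (\<lambda>x. usc_equiv P `` {cell_path n \<sigma> x})"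
proof -
  interpret Metric_space "poset_points P" poset_dist
    by (rule Metric_space_poset_real[OF P])
  show ?thesis
    unfolding poset_real_def continuous_map_to_metric
  proof (intro ballI allI impI)
    fix x and \<epsilon> :: real assume x: "x \<in> topspace (top_simplex n)" and \<epsilon>: "0 < \<epsilon>"
    define g where "g y = (\<Sum>k\<le>n. \<bar>partial_sum x k - partial_sum y k\<bar>)" for y
    define U where "U = {y \<in> topspace (top_simplex n). g y \<in> {..<\<epsilon>}}"
    have "continuous_map (top_simplex n) euclideanreal g"
      unfolding g_def partial_sum_def
      by (intro continuous_map_sum continuous_map_real_abs continuous_map_diff
          continuous_map_top_simplex_coordinate) auto
    then have "openin (top_simplex n) U"
      unfolding U_def by (rule openin_continuous_map_preimage) simp
    moreover have "x \<in> U"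
      using x \<epsilon> by (simp add: U_def g_def)
    moreover have "usc_equiv P `` {cell_path n \<sigma> y} \<in> mball (usc_equiv P `` {cell_path n \<sigma> x}) \<epsilon>"
      if "y \<in> U" for y
    proof -
      have xy: "x \<in> standard_simplex n" "y \<in> standard_simplex n" "g y < \<epsilon>"
        using x that by (auto simp: U_def topspace_top_simplex)
      note paths = cell_path_in_usc_maps[OF P \<sigma> xy(1)] cell_path_in_usc_maps[OF P \<sigma> xy(2)]
      have "usc_dist (cell_path n \<sigma> x) (cell_path n \<sigma> y) < \<epsilon>"
        using usc_dist_cell_path_le[OF P \<sigma> xy(1,2)] xy(3) by (simp add: g_def)
      then show ?thesis
        unfolding in_mball poset_dist_class[OF P paths]
        using paths by (simp add: poset_points_def quotientI)
    qed
    ultimately show "\<exists>U. openin (top_simplex n) U \<and> x \<in> U \<and>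
        (\<forall>y\<in>U. usc_equiv P `` {cell_path n \<sigma> y} \<in> mball (usc_equiv P `` {cell_path n \<sigma> x}) \<epsilon>)"
      by blast
  qed
qed

lemma continuous_map_realize:
  assumes P: "finite_poset P"
  shows "continuous_map (over_coproduct (simp_real P)) (poset_real P) (\<lambda>a. usc_equiv P `` {realize a})"
  unfolding over_coproduct_def
proof (rule continuous_map_sum_topology)
  fix i :: "nat \<times> (nat \<Rightarrow> (nat \<Rightarrow> nat) \<Rightarrow> nat \<Rightarrow> 'a)"
  assume "i \<in> over_objects (simp_real P)"
  then obtain n \<sigma> where "i = (n, simp_real_map (ordinal n) \<sigma>)" "\<sigma> \<in> order_maps (ordinal n) P"
    by (auto simp: over_objects_simp_real)
  then show "continuous_map (top_simplex (fst i)) (poset_real P) (\<lambda>x. usc_equiv P `` {realize (i, x)})"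
    using continuous_map_cell_path[OF P, of \<sigma> n] by (simp add: realize_cell)
qed

lemma quotient_map_quotient_topology: "quotient_map X (quotient_topology X r) (\<lambda>x. r `` {x})"
  unfolding quotient_map_def topspace_quotient_topology openin_quotient_topology
  by (auto simp: quotient_def)

text \<open>Degenerate simplices may occur in every dimension, but each point is glued to one in the
  simplex that enumerates its image, of dimension less than \<open>card (Field P)\<close>. The
  simplices up to dimension \<open>card (Field P)\<close> are finitely many and compact.\<close>

lemma compact_space_geom_real_simp_real:
  assumes P: "finite_poset P"
  shows "compact_space (geom_real (simp_real P))"
proof -
  let ?X = "over_coproduct (simp_real P)" and ?r = "over_equiv (simp_real P)"
  define J where "J = (\<Union>n\<in>{..card (Field P)}. (\<lambda>\<sigma>. (n, simp_real_map (ordinal n) \<sigma>)) ` order_maps (ordinal n) P)"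
  define K where "K = (\<Union>i\<in>J. Pair i ` standard_simplex (fst i))"
  have "finite (order_maps (ordinal n) P)" for n
    by (rule finite_subset[of _ "{..n} \<rightarrow>\<^sub>E Field P"])
       (auto simp: order_maps_def intro!: finite_PiE finite_posetD(1)[OF P])
  then have "finite J"
    by (simp add: J_def)
  moreover have "compactin ?X (Pair i ` standard_simplex (fst i))" if "i \<in> J" for i
  proof (rule image_compactin[OF compactin_top_simplex])
    have "i \<in> over_objects (simp_real P)"
      using that by (auto simp: J_def over_objects_simp_real)
    then show "continuous_map (top_simplex (fst i)) ?X (Pair i)"
      unfolding over_coproduct_def
      using continuous_map_component_injection[of i _ "\<lambda>a. top_simplex (fst a)"] by simp
  qed
  ultimately have K: "compactin ?X K"
    unfolding K_def by (intro compactin_Union) auto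
  have "topspace (geom_real (simp_real P)) \<subseteq> (\<lambda>a. ?r `` {a}) ` K"
  proof
    fix c assume "c \<in> topspace (geom_real (simp_real P))"
    then obtain a where a: "a \<in> topspace ?X" "c = ?r `` {a}"
      by (auto simp: geom_real_def topspace_quotient_topology elim: quotientE)
    then obtain n \<sigma> x where \<sigma>: "\<sigma> \<in> order_maps (ordinal n) P" "x \<in> standard_simplex n" "a = cell n \<sigma> x"
      by (auto simp: topspace_over_coproduct)
    have field: "\<sigma> ` {..n} \<subseteq> Field P"
      using order_maps_ordinalD(2)[OF \<sigma>(1)] by auto
    obtain k e where e: "card (\<sigma> ` {..n}) = Suc k" "e \<in> order_maps (ordinal k) P" "bij_betw e {..k} (\<sigma> ` {..n})"
      by (rule enumerate_finite_chain[OF P field _ order_maps_chain[OF \<sigma>(1)]]) auto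
    define b where "b = cell k e (chain_point k e (weight n \<sigma> x))"
    have glue: "over_glue (simp_real P) a b"
      unfolding b_def \<sigma>(3) by (rule over_glue_chain_point[OF P \<sigma>(1,2) e(2,3)]) simp
    then have b: "b \<in> topspace ?X" "(a, b) \<in> ?r"
      using a over_glue_realize(2)[OF P glue] by (auto simp: over_equiv_def)
    have "k \<le> card (Field P)"
      using card_mono[OF finite_posetD(1)[OF P] field] e(1) by simp
    moreover have "chain_point k e (weight n \<sigma> x) \<in> standard_simplex k"
      using b(1) by (simp add: b_def over_coproduct_def topspace_top_simplex)
    ultimately have "b \<in> K"
      using e(2) unfolding b_def K_def J_def by fastforce
    moreover have "c = ?r `` {b}"
      using a(2) equiv_class_eq[OF equiv_over_equiv b(2)] by simp
    ultimately show "c \<in> (\<lambda>a. ?r `` {a}) ` K" by blast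
  qed
  moreover have "compactin (geom_real (simp_real P)) ((\<lambda>a. ?r `` {a}) ` K)"
    unfolding geom_real_def
    by (intro image_compactin[OF K] quotient_imp_continuous_map quotient_map_quotient_topology)
  ultimately show ?thesis
    unfolding compact_space_def by (metis compactin_subset_topspace subset_antisym)
qed

section \<open>The comparison map\<close>

definition realize_class ::
  "'a rel \<Rightarrow> ((nat \<times> (nat \<Rightarrow> (nat \<Rightarrow> nat) \<Rightarrow> (nat \<Rightarrow> 'a))) \<times> (nat \<Rightarrow> real)) set \<Rightarrow> (real \<Rightarrow> 'a) set" where
  "realize_class P c = (\<Union>a\<in>c. usc_equiv P `` {realize a})"

lemma realize_class_eq:
  assumes P: "finite_poset P" and a: "a \<in> topspace (over_coproduct (simp_real P))"
  shows "realize_class P (over_equiv (simp_real P) `` {a}) = usc_equiv P `` {realize a}"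
  unfolding realize_class_def
proof (rule UN_equiv_class[OF equiv_over_equiv _ a], rule congruentI)
  fix b c assume bc: "(b, c) \<in> over_equiv (simp_real P)"
  then have "(realize b, realize c) \<in> usc_equiv P"
    using over_equiv_iff_realize[OF P, of b c] by (auto simp: over_equiv_def)
  then show "usc_equiv P `` {realize b} = usc_equiv P `` {realize c}"
    by (rule equiv_class_eq[OF equiv_usc_equiv[OF P]])
qed

lemma homeomorphic_map_realize_class:
  assumes P: "finite_poset P"
  shows "homeomorphic_map (geom_real (simp_real P)) (poset_real P) (realize_class P)"
proof (rule continuous_imp_homeomorphic_map)
  let ?X = "over_coproduct (simp_real P)" and ?r = "over_equiv (simp_real P)"
  have top: "topspace (geom_real (simp_real P)) = (\<lambda>a. ?r `` {a}) ` topspace ?X"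
    by (auto simp: geom_real_def topspace_quotient_topology quotient_def)
  have "continuous_map ?X (poset_real P) (realize_class P \<circ> (\<lambda>a. ?r `` {a}))"
    using continuous_map_realize[OF P] by (rule continuous_map_eq) (simp add: realize_class_eq[OF P])
  then show "continuous_map (geom_real (simp_real P)) (poset_real P) (realize_class P)"
    unfolding geom_real_def by (rule continuous_compose_quotient_map[OF quotient_map_quotient_topology])
  show "compact_space (geom_real (simp_real P))"
    by (rule compact_space_geom_real_simp_real[OF P])
  show "Hausdorff_space (poset_real P)"
    unfolding poset_real_def by (rule Metric_space.Hausdorff_space_mtopology[OF Metric_space_poset_real[OF P]])
  show "realize_class P ` topspace (geom_real (simp_real P)) = topspace (poset_real P)"
  proof
    show "realize_class P ` topspace (geom_real (simp_real P)) \<subseteq> topspace (poset_real P)"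
      by (auto simp: top realize_class_eq[OF P] topspace_poset_real[OF P] intro!: quotientI realize_in_usc_maps[OF P])
    show "topspace (poset_real P) \<subseteq> realize_class P ` topspace (geom_real (simp_real P))"
    proof
      fix F assume "F \<in> topspace (poset_real P)"
      then obtain f where f: "f \<in> usc_maps P" "F = usc_equiv P `` {f}"
        by (auto simp: topspace_poset_real[OF P] elim: quotientE)
      obtain a where a: "a \<in> topspace ?X" "(f, realize a) \<in> usc_equiv P"
        using realize_surj[OF P f(1)] .
      then have "F = realize_class P (?r `` {a})"
        using f(2) equiv_class_eq[OF equiv_usc_equiv[OF P] a(2)] by (simp add: realize_class_eq[OF P])
      then show "F \<in> realize_class P ` topspace (geom_real (simp_real P))"
        using a(1) by (auto simp: top)
    qed
  qed
  show "inj_on (realize_class P) (topspace (geom_real (simp_real P)))"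
    unfolding top
  proof (rule inj_onI, clarify)
    fix a b assume ab: "a \<in> topspace ?X" "b \<in> topspace ?X"
      and "realize_class P (?r `` {a}) = realize_class P (?r `` {b})"
    then have "usc_equiv P `` {realize a} = usc_equiv P `` {realize b}"
      by (simp add: realize_class_eq[OF P])
    then have "(realize a, realize b) \<in> usc_equiv P"
      using eq_equiv_class_iff[OF equiv_usc_equiv[OF P]] ab realize_in_usc_maps[OF P] by blast
    then show "?r `` {a} = ?r `` {b}"
      using over_equiv_iff_realize[OF P ab] equiv_class_eq[OF equiv_over_equiv] by blast
  qed
qed

section \<open>Naturality\<close>

text \<open>Independence of the representative is not traced through gluings. The image of
  \<open>a\<close> is represented by a point whose path is \<open>h\<close> composed with the path
  of \<open>a\<close>, so equivalence can be tested on paths, over \<open>P\<close> and over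
  \<open>Q\<close>, by \<open>over_equiv_iff_realize\<close>.\<close>

lemma geom_real_map_cell:
  assumes P: "finite_poset P" and Q: "finite_poset Q" and h: "h \<in> order_maps P Q"
    and \<sigma>: "\<sigma> \<in> order_maps (ordinal n) P" and x: "x \<in> standard_simplex n"
  shows "geom_real_map (simp_real Q) (simp_real_map P h) (over_equiv (simp_real P) `` {cell n \<sigma> x}) =
    over_equiv (simp_real Q) `` {cell n (compose {..n} h \<sigma>) x}"
proof -
  let ?r = "over_equiv (simp_real Q)"
  define F where "F = (\<lambda>((n, \<alpha>), x). ?r `` {((n, sset_comp (Delta n) (simp_real_map P h) \<alpha>), x)})"
  have F_cell: "F (cell m \<tau> y) = ?r `` {cell m (compose {..m} h \<tau>) y}"
    if "\<tau> \<in> order_maps (ordinal m) P" for m \<tau> y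
    using that by (simp add: F_def sset_comp_simp_real_map)
  have "F respects over_equiv (simp_real P)"
  proof (rule congruentI)
    fix a b assume ab: "(a, b) \<in> over_equiv (simp_real P)"
    then have top: "a \<in> topspace (over_coproduct (simp_real P))" "b \<in> topspace (over_coproduct (simp_real P))"
      by (auto simp: over_equiv_def)
    have image: "\<exists>a'. a' \<in> topspace (over_coproduct (simp_real Q)) \<and> F a = ?r `` {a'} \<and>
        realize a' = compose {0..1} h (realize a)"
      if a: "a \<in> topspace (over_coproduct (simp_real P))" for a
    proof -
      obtain m \<tau> y where \<tau>: "\<tau> \<in> order_maps (ordinal m) P" "y \<in> standard_simplex m" "a = cell m \<tau> y"
        using a unfolding topspace_over_coproduct by blast
      have "compose {..m} h \<tau> \<in> order_maps (ordinal m) Q"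
        using order_maps_compose[OF \<tau>(1) h] by simp
      then show ?thesis
        using \<tau> by (intro exI[of _ "cell m (compose {..m} h \<tau>) y"])
          (auto simp: topspace_over_coproduct F_cell realize_cell compose_cell_path)
    qed
    obtain a' b' where a': "a' \<in> topspace (over_coproduct (simp_real Q))" "F a = ?r `` {a'}"
        "realize a' = compose {0..1} h (realize a)"
      and b': "b' \<in> topspace (over_coproduct (simp_real Q))" "F b = ?r `` {b'}"
        "realize b' = compose {0..1} h (realize b)"
      using image[OF top(1)] image[OF top(2)] by blast
    have "(realize a', realize b') \<in> usc_equiv Q"
      unfolding a'(3) b'(3) using ab over_equiv_iff_realize[OF P top]
      by (intro usc_equiv_compose[OF P Q h]) simp
    then show "F a = F b"
      unfolding a'(2) b'(2)
      using over_equiv_iff_realize[OF Q a'(1) b'(1)] equiv_class_eq[OF equiv_over_equiv] by blast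
  qed
  moreover have "cell n \<sigma> x \<in> topspace (over_coproduct (simp_real P))"
    using \<sigma> x by (auto simp: topspace_over_coproduct)
  ultimately have "(\<Union>a\<in>over_equiv (simp_real P) `` {cell n \<sigma> x}. F a) = F (cell n \<sigma> x)"
    by (rule UN_equiv_class[OF equiv_over_equiv])
  then show ?thesis
    by (simp only: geom_real_map_def F_def[symmetric] F_cell[OF \<sigma>])
qed

lemma poset_real_map_class:
  assumes P: "finite_poset P" and Q: "finite_poset Q" and h: "h \<in> order_maps P Q" and f: "f \<in> usc_maps P"
  shows "poset_real_map Q h (usc_equiv P `` {f}) = usc_equiv Q `` {compose {0..1} h f}"
  unfolding poset_real_map_def
proof (rule UN_equiv_class[OF equiv_usc_equiv[OF P] _ f], rule congruentI)
  fix g k assume "(g, k) \<in> usc_equiv P"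
  then show "usc_equiv Q `` {compose {0..1} h g} = usc_equiv Q `` {compose {0..1} h k}"
    by (intro equiv_class_eq[OF equiv_usc_equiv[OF Q]] usc_equiv_compose[OF P Q h])
qed

text \<open>On a cell, both sides of the equation are the class of the same path. The membership
  statement is what later permits cancelling \<open>realize_class Q\<close> against its
  inverse.\<close>

lemma realize_class_natural:
  assumes P: "finite_poset P" and Q: "finite_poset Q" and h: "h \<in> order_maps P Q"
    and c: "c \<in> topspace (geom_real (simp_real P))"
  shows "geom_real_map (simp_real Q) (simp_real_map P h) c \<in> topspace (geom_real (simp_real Q))"
    and "realize_class Q (geom_real_map (simp_real Q) (simp_real_map P h) c) =
      poset_real_map Q h (realize_class P c)"
proof -
  obtain a where a: "a \<in> topspace (over_coproduct (simp_real P))" "c = over_equiv (simp_real P) `` {a}"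
    using c by (auto simp: geom_real_def topspace_quotient_topology elim: quotientE)
  then obtain n \<sigma> x where \<sigma>: "\<sigma> \<in> order_maps (ordinal n) P" and x: "x \<in> standard_simplex n"
    and a_eq: "a = cell n \<sigma> x"
    by (auto simp: topspace_over_coproduct)
  have h\<sigma>: "compose {..n} h \<sigma> \<in> order_maps (ordinal n) Q"
    using order_maps_compose[OF \<sigma> h] by simp
  then have b: "cell n (compose {..n} h \<sigma>) x \<in> topspace (over_coproduct (simp_real Q))"
    using x by (auto simp: topspace_over_coproduct)
  have image: "geom_real_map (simp_real Q) (simp_real_map P h) c =
      over_equiv (simp_real Q) `` {cell n (compose {..n} h \<sigma>) x}"
    unfolding a(2) a_eq by (rule geom_real_map_cell[OF P Q h \<sigma> x])
  show "geom_real_map (simp_real Q) (simp_real_map P h) c \<in> topspace (geom_real (simp_real Q))"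
    unfolding image using b by (simp add: geom_real_def topspace_quotient_topology quotientI)
  show "realize_class Q (geom_real_map (simp_real Q) (simp_real_map P h) c) =
      poset_real_map Q h (realize_class P c)"
    unfolding image realize_class_eq[OF Q b] unfolding a(2) realize_class_eq[OF P a(1)]
      poset_real_map_class[OF P Q h realize_in_usc_maps[OF P a(1)]]
    by (simp add: a_eq realize_cell[OF \<sigma>] realize_cell[OF h\<sigma>] compose_cell_path)
qed

theorem proposition3p5:
  shows "\<exists>\<Phi> :: 'a rel \<Rightarrow> (real \<Rightarrow> 'a) set \<Rightarrow>
            ((nat \<times> (nat \<Rightarrow> (nat \<Rightarrow> nat) \<Rightarrow> (nat \<Rightarrow> 'a))) \<times> (nat \<Rightarrow> real)) set.
     (\<forall>P. finite_poset P \<longrightarrow>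
        homeomorphic_map (poset_real P) (geom_real (simp_real P)) (\<Phi> P)) \<and>
     (\<forall>P Q h. finite_poset P \<and> finite_poset Q \<and> h \<in> order_maps P Q \<longrightarrow>
        (\<forall>x \<in> topspace (poset_real P).
           \<Phi> Q (poset_real_map Q h x) =
           geom_real_map (simp_real Q) (simp_real_map P h) (\<Phi> P x)))"
proof -
  \<comment> \<open>The existential covers all relations, so that one choice yields a family of
    inverses \<open>\<Phi>\<close>.\<close>
  have "\<forall>P :: 'a rel. \<exists>\<phi>. finite_poset P \<longrightarrow>
      homeomorphic_maps (geom_real (simp_real P)) (poset_real P) (realize_class P) \<phi>"
    using homeomorphic_map_realize_class homeomorphic_map_maps by blast
  then obtain \<Phi> where \<Phi>: "homeomorphic_maps (geom_real (simp_real P)) (poset_real P) (realize_class P) (\<Phi> P)"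
    if "finite_poset P" for P :: "'a rel"
    by metis
  have "homeomorphic_map (poset_real P) (geom_real (simp_real P)) (\<Phi> P)" if "finite_poset P" for P
    using \<Phi>[OF that] by (simp add: homeomorphic_maps_map)
  moreover have "\<Phi> Q (poset_real_map Q h F) = geom_real_map (simp_real Q) (simp_real_map P h) (\<Phi> P F)"
    if P: "finite_poset P" and Q: "finite_poset Q" and h: "h \<in> order_maps P Q"
      and F: "F \<in> topspace (poset_real P)" for P Q h F
  proof -
    have top: "\<Phi> P F \<in> topspace (geom_real (simp_real P))" and F_eq: "realize_class P (\<Phi> P F) = F"
      using \<Phi>[OF P] F by (auto simp: homeomorphic_maps_def continuous_map_def)
    \<comment> \<open>Naturality passes to inverses: \<open>\<Phi> Q\<close> undoes
      \<open>realize_class Q\<close>, and the argument is then rewritten by naturality at the point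
      \<open>\<Phi> P F\<close>.\<close>
    have "\<Phi> Q (realize_class Q (geom_real_map (simp_real Q) (simp_real_map P h) (\<Phi> P F))) =
        geom_real_map (simp_real Q) (simp_real_map P h) (\<Phi> P F)"
      using \<Phi>[OF Q] realize_class_natural(1)[OF P Q h top] by (simp add: homeomorphic_maps_def)
    then show ?thesis
      by (simp only: realize_class_natural(2)[OF P Q h top] F_eq)
  qed
  ultimately show ?thesis
    by blast
qed

end
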